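(* Let $n\ge 1$ be an integer, let $I\subset\mathbb{R}$ be a nonempty open interval, let $M\subset\mathbb{R}^n$ be an open set, and let $v\colon I\times M\to\mathbb{R}^n$ be a continuously differentiable function. Assume that there is a continuous function $L\colon I\to[0,+\infty[$ such that $$\|v(t,x_1)-v(t,x_2)\|\le L(t)\,\|x_1-x_2\|\qquad (t\in I,\ x_1,x_2\in M),$$ and that for every $t_0\in I$ and $x_0\in M$ the unique maximal solution of the Cauchy problem $\dot{x}(t)=v(t,x(t))$, $x(t_0)=x_0$, cannot leave the domain $I\times M$, i.e. it is defined on the whole of $I$ with values in $M$. Then the global symmetry group $\mathcal{G}$ of the equation $\dot{x}(t)=v(t,x)$ is isomorphic to the smooth wreath product of the group of all diffeomorphisms of $I$ and the group of all diffeomorphisms of $M$: $$\mathcal{G}\simeq\mathcal{SYM}(I)\wr_{\mathcal{C}^1}\mathcal{SYM}(M).$$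
   Context: "Smooth" means continuously differentiable ($\mathcal{C}^1$). A diffeomorphism is a bijection such that both it and its inverse are smooth, and $\mathcal{SYM}(X)$ denotes the group (under composition) of all diffeomorphisms of $X$ onto itself. Global symmetry group. A solution of $\dot{x}=v(t,x)$ is a smooth function $\varphi\colon J\to M$, for some nonempty open interval $J\subseteq I$, with $\varphi'(t)=v(t,\varphi(t))$ for all $t\in J$. For a map $\alpha\colon I\times M\to I\times M$ and a function $\varphi\colon J\to M$ with graph $\Gamma_\varphi=\{(t,\varphi(t)):t\in J\}$, if $\alpha(\Gamma_\varphi)$ is the graph of a function $\tilde\varphi$, one says that $\alpha\circ\varphi$ is defined and writes $\tilde\varphi=\alpha\circ\varphi$ (the transform of $\varphi$ by $\alpha$). A global symmetry of $\dot{x}=v(t,x)$ is a diffeomorphism $\alpha\in\mathcal{SYM}(I\times M)$ that moves solutions to solutions: for every solution $\varphi$, the transform $\alpha\circ\varphi$ is defined and is a solution. The global symmetry group $\mathcal{G}$ is the group of all global symmetries, under composition. Smooth wreath product. Let $A=\mathcal{SYM}(I)$ and $B=\mathcal{SYM}(M)$. Let $F$ be the group, under pointwise multiplication (composition in $A$), of all smooth functions $f\colon M\to A$, where $f$ is smooth if the map $I\times M\to I$, $(t,x)\mapsto f(x)(t)$, is continuously differentiable. The group $B$ acts on $F$ by $f^g(x)=f(g^{-1}(x))$. Then $A\wr_{\mathcal{C}^1}B$ is the semidirect product $F\rtimes B$, i.e. the set of pairs $(f,g)$ with $f\in F$, $g\in B$ and multiplication $$(f_1,g_1)(f_2,g_2)=\bigl(f_1^{g_2^{-1}}\circ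 f_2,\ g_1\circ g_2\bigr),$$ where the first component is the function $x\mapsto f_1(g_2(x))\circ f_2(x)$. *)

theory Defs
  imports "HOL-Analysis.Analysis" "HOL-Algebra.Bij"
begin

text \<open>Meant for open sets \<open>U\<close>. On \<open>I \<times> M\<close> this is joint continuous differentiability.\<close>
definition C1_on :: "('a::real_normed_vector \<Rightarrow> 'b::real_normed_vector) \<Rightarrow> 'a set \<Rightarrow> bool" where
  "C1_on f U \<longleftrightarrow>
     (\<exists>f' :: 'a \<Rightarrow> 'a \<Rightarrow>\<^sub>L 'b.
        (\<forall>x\<in>U. (f has_derivative blinfun_apply (f' x)) (at x)) \<and> continuous_on U f')"

text \<open>As in \<^const>\<open>BijGroup\<close>, a self-map of \<open>X\<close> is represented by a function that is
  \<^const>\<open>undefined\<close> outside \<open>X\<close>, so that each map has exactly one representative.\<close>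
definition SYM :: "'a::real_normed_vector set \<Rightarrow> ('a \<Rightarrow> 'a) monoid" where
  "SYM X = BijGroup X
     \<lparr>carrier := {g \<in> Bij X. C1_on g X \<and> C1_on (inv_into X g) X}\<rparr>"

definition is_solution ::
  "real set \<Rightarrow> 'a::real_normed_vector set \<Rightarrow> (real \<times> 'a \<Rightarrow> 'a) \<Rightarrow> real set \<Rightarrow> (real \<Rightarrow> 'a) \<Rightarrow> bool" where
  "is_solution I M v J \<phi> \<longleftrightarrow>
     J \<noteq> {} \<and> open J \<and> is_interval J \<and> J \<subseteq> I \<and> \<phi> ` J \<subseteq> M \<and> C1_on \<phi> J \<and>
     (\<forall>t\<in>J. (\<phi> has_vector_derivative v (t, \<phi> t)) (at t))"

definition cauchy_solution ::
  "real set \<Rightarrow> 'a::real_normed_vector set \<Rightarrow> (real \<times> 'a \<Rightarrow> 'a) \<Rightarrow> real \<Rightarrow> 'a \<Rightarrow>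
     real set \<Rightarrow> (real \<Rightarrow> 'a) \<Rightarrow> bool" where
  "cauchy_solution I M v t0 x0 J \<phi> \<longleftrightarrow> is_solution I M v J \<phi> \<and> t0 \<in> J \<and> \<phi> t0 = x0"

definition maximal_cauchy_solution ::
  "real set \<Rightarrow> 'a::real_normed_vector set \<Rightarrow> (real \<times> 'a \<Rightarrow> 'a) \<Rightarrow> real \<Rightarrow> 'a \<Rightarrow>
     real set \<Rightarrow> (real \<Rightarrow> 'a) \<Rightarrow> bool" where
  "maximal_cauchy_solution I M v t0 x0 J \<phi> \<longleftrightarrow>
     cauchy_solution I M v t0 x0 J \<phi> \<and>
     (\<forall>K \<psi>. cauchy_solution I M v t0 x0 K \<psi> \<and> J \<subseteq> K \<and> (\<forall>t\<in>J. \<psi> t = \<phi> t) \<longrightarrow> K = J)"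

definition graph_on :: "real set \<Rightarrow> (real \<Rightarrow> 'a) \<Rightarrow> (real \<times> 'a) set" where
  "graph_on J \<phi> = (\<lambda>t. (t, \<phi> t)) ` J"

text \<open>The transform \<open>\<alpha> \<circ> \<phi>\<close> is the function \<open>\<psi>\<close> on \<open>K\<close> whose graph is the image under \<open>\<alpha>\<close> of the
  graph of \<open>\<phi>\<close>; the graph determines \<open>K\<close> and the values of \<open>\<psi>\<close> on \<open>K\<close>.\<close>
definition is_transform ::
  "(real \<times> 'a \<Rightarrow> real \<times> 'a) \<Rightarrow> real set \<Rightarrow> (real \<Rightarrow> 'a) \<Rightarrow> real set \<Rightarrow> (real \<Rightarrow> 'a) \<Rightarrow> bool" where
  "is_transform \<alpha> J \<phi> K \<psi> \<longleftrightarrow> \<alpha> ` graph_on J \<phi> = graph_on K \<psi>"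

definition global_symmetry ::
  "real set \<Rightarrow> 'a::real_normed_vector set \<Rightarrow> (real \<times> 'a \<Rightarrow> 'a) \<Rightarrow> (real \<times> 'a \<Rightarrow> real \<times> 'a) \<Rightarrow> bool" where
  "global_symmetry I M v \<alpha> \<longleftrightarrow>
     \<alpha> \<in> carrier (SYM (I \<times> M)) \<and>
     (\<forall>J \<phi>. is_solution I M v J \<phi> \<longrightarrow>
        (\<exists>K \<psi>. is_transform \<alpha> J \<phi> K \<psi> \<and> is_solution I M v K \<psi>))"

definition global_symmetry_group ::
  "real set \<Rightarrow> 'a::real_normed_vector set \<Rightarrow> (real \<times> 'a \<Rightarrow> 'a) \<Rightarrow> (real \<times> 'a \<Rightarrow> real \<times> 'a) monoid" where
  "global_symmetry_group I M v = (SYM (I \<times> M))\<lparr>carrier := {\<alpha>. global_symmetry I M v \<alpha>}\<rparr>"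

text \<open>Smoothness of \<open>f : M \<rightarrow> SYM I\<close> means joint smoothness of \<open>(t, x) \<mapsto> f x t\<close>.\<close>
definition smooth_fun_group ::
  "real set \<Rightarrow> 'a::real_normed_vector set \<Rightarrow> ('a \<Rightarrow> real \<Rightarrow> real) monoid" where
  "smooth_fun_group I M =
     \<lparr>carrier = {f \<in> M \<rightarrow>\<^sub>E carrier (SYM I). C1_on (\<lambda>(t, x). f x t) (I \<times> M)},
      mult = (\<lambda>f1 f2. \<lambda>x\<in>M. f1 x \<otimes>\<^bsub>SYM I\<^esub> f2 x),
      one = (\<lambda>x\<in>M. \<one>\<^bsub>SYM I\<^esub>)\<rparr>"

text \<open>\<open>f\<^sup>g(x) = f(g\<^sup>-\<^sup>1 x)\<close>.\<close>
definition fun_action :: "'a set \<Rightarrow> ('a \<Rightarrow> real \<Rightarrow> real) \<Rightarrow> ('a \<Rightarrow> 'a) \<Rightarrow> 'a \<Rightarrow> real \<Rightarrow> real" where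
  "fun_action M f g = (\<lambda>x\<in>M. f (inv_into M g x))"

text \<open>The semidirect product \<open>F \<rtimes> SYM M\<close>, with
  \<open>(f1, g1) (f2, g2) = (f1\<^sup>h f2, g1 g2)\<close> where \<open>h\<close> is the inverse of \<open>g2\<close>.\<close>
definition smooth_wreath ::
  "real set \<Rightarrow> 'a::real_normed_vector set \<Rightarrow> (('a \<Rightarrow> real \<Rightarrow> real) \<times> ('a \<Rightarrow> 'a)) monoid" where
  "smooth_wreath I M =
     \<lparr>carrier = carrier (smooth_fun_group I M) \<times> carrier (SYM M),
      mult = (\<lambda>(f1, g1) (f2, g2).
        (fun_action M f1 (inv_into M g2) \<otimes>\<^bsub>smooth_fun_group I M\<^esub> f2, g1 \<otimes>\<^bsub>SYM M\<^esub> g2)),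
      one = (\<one>\<^bsub>smooth_fun_group I M\<^esub>, \<one>\<^bsub>SYM M\<^esub>)\<rparr>"

lemma smooth_wreath_mult:
  assumes "(f1, g1) \<in> carrier (smooth_wreath I M)" "(f2, g2) \<in> carrier (smooth_wreath I M)"
  shows "(f1, g1) \<otimes>\<^bsub>smooth_wreath I M\<^esub> (f2, g2) =
    (\<lambda>x\<in>M. compose I (f1 (g2 x)) (f2 x), compose M g1 g2)"
proof -
  have g: "g1 \<in> Bij M" "g2 \<in> Bij M"
    and f: "\<And>x. x \<in> M \<Longrightarrow> f1 x \<in> Bij I" "\<And>x. x \<in> M \<Longrightarrow> f2 x \<in> Bij I"
    using assms by (auto simp: smooth_wreath_def smooth_fun_group_def SYM_def PiE_iff)
  then have b: "bij_betw g2 M M"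
    by (simp add: Bij_def)
  have "inv_into M (inv_into M g2) x = g2 x" "g2 x \<in> M" if "x \<in> M" for x
    using that b inv_into_inv_into_eq bij_betwE by fastforce+
  then show ?thesis
    using g f
    by (auto simp: smooth_wreath_def smooth_fun_group_def fun_action_def SYM_def BijGroup_def
        intro!: restrict_ext)
qed

end

theory Submission
  imports Defs
begin

text \<open>When every solution lives on all of \<open>I\<close>, the graphs of the maximal solutions are disjoint curves
that fill \<open>I \<times> M\<close>, each crossing the slice over a fixed time exactly once. Labelling a solution by
its value \<open>x\<close> at that time gives the map \<open>\<Phi> (t, x) = (t, flow (t, x))\<close>, called \<open>straightening\<close>,
which turns each horizontal line \<open>I \<times> {x}\<close> into the graph of a solution. As \<open>\<Phi>\<close> is a diffeomorphism
of \<open>I \<times> M\<close> (\<open>straightening_in_SYM\<close>), conjugation by it identifies the symmetries of the given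
equation with those of \<open>x' = 0\<close>, the diffeomorphisms that send each horizontal segment
\<open>J \<times> {x}\<close> onto a horizontal segment (\<open>global_symmetry_iff\<close>).

Such a diffeomorphism sends \<open>I \<times> {x}\<close> onto some \<open>K \<times> {g x}\<close>. For a fixed height \<open>y\<close> the sets \<open>K\<close> that
belong to the \<open>x\<close> with \<open>g x = y\<close> partition \<open>I\<close> into nonempty open sets; connectedness of \<open>I\<close>
leaves room for a single one. So whole lines go to whole lines, \<open>g\<close> is a bijection, and the map
has the form \<open>(t, x) \<mapsto> (f x t, g x)\<close> with each \<open>f x\<close> a diffeomorphism of \<open>I\<close>
(\<open>horizontal_diffeo_preserves_lines\<close>, \<open>horizontal_diffeo_is_wreath_action\<close>). Composing two maps of
this form is the multiplication of the wreath product.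

The analytic content is that \<open>\<Phi>\<close> and its inverse are continuously differentiable. Gronwall's
inequality makes the flow Lipschitz in the initial value, both forwards and backwards in time. The
derivative is obtained without solving the variational equation. For \<open>a k = b l\<close> the difference
\<open>a (flow (s, y + k) - flow (s, y)) - b (flow (s, z + l) - flow (s, z))\<close> vanishes at the initial time
and satisfies the linearized equation up to a small relative error, so by Gronwall it stays small
(\<open>flow_strictly_differentiable\<close>). All difference quotients in the same direction are thus nearly
equal, uniformly over nearby times and base points, and this one estimate gives existence,
linearity and continuity of the derivative at once (\<open>C1_on_strictly_differentiable_family\<close>). The
backward Lipschitz bound makes the derivative injective, and the inverse function theorem takes
care of \<open>\<Phi>\<close>'s inverse (\<open>C1_on_inv_into\<close>).\<close>

section \<open>Continuously differentiable maps and their inverses\<close>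

text \<open>In finite dimension, continuity of the derivative in operator norm amounts to continuity of its
  values on fixed vectors, which is easier to verify for derivatives given by formulas.\<close>
lemma C1_on_componentwise:
  fixes f :: "'a::euclidean_space \<Rightarrow> 'b::real_normed_vector"
  shows "C1_on f U \<longleftrightarrow> (\<exists>f'. (\<forall>x\<in>U. (f has_derivative f' x) (at x)) \<and>
    (\<forall>h. continuous_on U (\<lambda>x. f' x h)))"
proof
  assume "C1_on f U"
  then obtain f' where "\<forall>x\<in>U. (f has_derivative blinfun_apply (f' x)) (at x)" "continuous_on U f'"
    unfolding C1_on_def by blast
  then show "\<exists>f'. (\<forall>x\<in>U. (f has_derivative f' x) (at x)) \<and> (\<forall>h. continuous_on U (\<lambda>x. f' x h))"
    by (intro exI[of _ "\<lambda>x. blinfun_apply (f' x)"]) (auto intro!: continuous_intros)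
next
  assume "\<exists>f'. (\<forall>x\<in>U. (f has_derivative f' x) (at x)) \<and> (\<forall>h. continuous_on U (\<lambda>x. f' x h))"
  then obtain f' where f': "\<And>x. x \<in> U \<Longrightarrow> (f has_derivative f' x) (at x)"
    and cont: "\<And>h. continuous_on U (\<lambda>x. f' x h)"
    by blast
  have app: "blinfun_apply (Blinfun (f' x)) = f' x" if "x \<in> U" for x
    using f'[OF that] by (simp add: bounded_linear_Blinfun_apply has_derivative_bounded_linear)
  have "continuous_on U (\<lambda>x. Blinfun (f' x))"
  proof (rule continuous_on_blinfun_componentwise)
    fix i :: 'a
    show "continuous_on U (\<lambda>x. blinfun_apply (Blinfun (f' x)) i)"
      using cont[of i] by (rule continuous_on_eq) (simp add: app)
  qed
  then show "C1_on f U"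
    unfolding C1_on_def using f' app by (intro exI[of _ "\<lambda>x. Blinfun (f' x)"]) auto
qed

lemma C1_on_continuous_on: "C1_on f U \<Longrightarrow> continuous_on U f"
  unfolding C1_on_def
  by (meson continuous_at_imp_continuous_on has_derivative_continuous)

lemma C1_on_cong:
  assumes "open U" "\<And>x. x \<in> U \<Longrightarrow> f x = g x"
  shows "C1_on f U \<longleftrightarrow> C1_on g U"
proof -
  have *: "(g has_derivative D) (at x)" if "(f has_derivative D) (at x)" "x \<in> U"
    "\<And>x. x \<in> U \<Longrightarrow> f x = g x" for f g :: "'a \<Rightarrow> 'b" and D x
    using has_derivative_transform_within_open[OF that(1) assms(1)] that by blast
  show ?thesis
    unfolding C1_on_def using *[of f _ _ g] *[of g _ _ f] assms(2) by metis
qed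

lemma C1_on_subset: "C1_on f U \<Longrightarrow> V \<subseteq> U \<Longrightarrow> C1_on f V"
  unfolding C1_on_def using continuous_on_subset by blast

lemma C1_on_compose:
  assumes "C1_on g V" "C1_on f U" "f ` U \<subseteq> V"
  shows "C1_on (\<lambda>x. g (f x)) U"
proof -
  obtain f' g' where
    f': "\<And>x. x \<in> U \<Longrightarrow> (f has_derivative blinfun_apply (f' x)) (at x)" "continuous_on U f'" and
    g': "\<And>y. y \<in> V \<Longrightarrow> (g has_derivative blinfun_apply (g' y)) (at y)" "continuous_on V g'"
    using assms(1,2) unfolding C1_on_def by blast
  show ?thesis
    unfolding C1_on_def
  proof (intro exI[of _ "\<lambda>x. g' (f x) o\<^sub>L f' x"] conjI ballI)
    fix x assume "x \<in> U"
    then show "((\<lambda>x. g (f x)) has_derivative blinfun_apply (g' (f x) o\<^sub>L f' x)) (at x)"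
      using has_derivative_compose[OF f'(1) g'(1), of x] assms(3)
      by (auto simp: image_subset_iff blinfun_compose.rep_eq o_def)
  next
    have "continuous_on U (\<lambda>x. g' (f x))"
      using continuous_on_compose2[OF g'(2) C1_on_continuous_on[OF assms(2)] assms(3)] .
    with f'(2) show "continuous_on U (\<lambda>x. g' (f x) o\<^sub>L f' x)"
      by (intro continuous_intros)
  qed
qed

lemma C1_on_bounded_linear: "bounded_linear f \<Longrightarrow> C1_on f U"
  unfolding C1_on_def
  by (intro exI[of _ "\<lambda>_. Blinfun f"])
    (auto simp: bounded_linear_Blinfun_apply intro: bounded_linear_imp_has_derivative)

lemma C1_on_const: "C1_on (\<lambda>_. c) U"
  unfolding C1_on_def by (intro exI[of _ "\<lambda>_. 0"]) (auto simp: zero_blinfun.rep_eq)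

lemma C1_on_Pair:
  fixes f :: "'a::euclidean_space \<Rightarrow> 'b::real_normed_vector" and g :: "'a \<Rightarrow> 'c::real_normed_vector"
  assumes "C1_on f U" "C1_on g U"
  shows "C1_on (\<lambda>x. (f x, g x)) U"
proof -
  obtain f' g' where
    "\<And>x. x \<in> U \<Longrightarrow> (f has_derivative f' x) (at x)" "\<And>h. continuous_on U (\<lambda>x. f' x h)"
    "\<And>x. x \<in> U \<Longrightarrow> (g has_derivative g' x) (at x)" "\<And>h. continuous_on U (\<lambda>x. g' x h)"
    using assms unfolding C1_on_componentwise by blast
  then show ?thesis
    unfolding C1_on_componentwise
    by (intro exI[of _ "\<lambda>x h. (f' x h, g' x h)"])
      (auto intro!: continuous_on_Pair has_derivative_Pair)
qed

lemmas C1_on_id = C1_on_bounded_linear[OF bounded_linear_ident]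
lemmas C1_on_fst = C1_on_bounded_linear[OF bounded_linear_fst]
lemmas C1_on_snd = C1_on_bounded_linear[OF bounded_linear_snd]

text \<open>By the chain rule the derivative of \<open>g\<close> is a left inverse of the derivative of \<open>f\<close>.\<close>
lemma derivative_injective_if_left_inverse:
  assumes "(f has_derivative f') (at x)" "(g has_derivative g') (at (f x))"
    and "open U" "x \<in> U" "\<And>y. y \<in> U \<Longrightarrow> g (f y) = y" and "f' h = 0"
  shows "h = 0"
proof -
  have "((\<lambda>y. g (f y)) has_derivative (\<lambda>h. g' (f' h))) (at x)"
    using has_derivative_compose[OF assms(1,2)] .
  then have "((\<lambda>y. y) has_derivative (\<lambda>h. g' (f' h))) (at x)"
    by (rule has_derivative_transform_within_open[OF _ assms(3,4)]) (use assms(5) in auto)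
  then have "(\<lambda>h. g' (f' h)) = (\<lambda>h. h)"
    by (rule has_derivative_unique) (rule has_derivative_ident)
  then have "h = g' (f' h)" by metis
  also have "\<dots> = 0"
    using assms(2,6) by (simp add: linear_0 has_derivative_linear)
  finally show ?thesis .
qed

text \<open>Inversion of operators is continuous: \<open>S' - S = S' (T - T') S\<close>, and \<open>norm S'\<close> on the right is
  at most \<open>norm S + norm (S' - S)\<close>, whose last term is absorbed on the left when \<open>T'\<close> is close to \<open>T\<close>.\<close>
lemma norm_inverse_blinfun_diff_le:
  fixes S T :: "'a::real_normed_vector \<Rightarrow>\<^sub>L 'a"
  assumes "T o\<^sub>L S = id_blinfun" "S' o\<^sub>L T' = id_blinfun"
    and small: "norm S * norm (T - T') \<le> 1/2"
  shows "norm (S' - S) \<le> 2 * (norm S)\<^sup>2 * norm (T - T')"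
proof -
  have "S' - S = S' o\<^sub>L (T - T') o\<^sub>L S"
  proof (rule blinfun_eqI)
    fix x
    have "blinfun_apply (T o\<^sub>L S) x = x" "blinfun_apply (S' o\<^sub>L T') (S x) = S x"
      by (simp_all add: assms)
    then have "T (S x) = x" "S' (T' (S x)) = S x"
      by simp_all
    then show "blinfun_apply (S' - S) x = blinfun_apply (S' o\<^sub>L (T - T') o\<^sub>L S) x"
      by (simp add: blinfun.bilinear_simps)
  qed
  then have "norm (S' - S) \<le> norm (S' o\<^sub>L (T - T')) * norm S"
    by (simp only: norm_blinfun_compose)
  also have "\<dots> \<le> norm S' * norm (T - T') * norm S"
    by (intro mult_right_mono norm_blinfun_compose norm_ge_zero)
  also have "\<dots> = norm S' * (norm S * norm (T - T'))" by simp
  also have "\<dots> \<le> (norm S + norm (S' - S)) * (norm S * norm (T - T'))"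
    using norm_triangle_ineq[of S "S' - S"] by (intro mult_right_mono) auto
  also have "\<dots> \<le> (norm S)\<^sup>2 * norm (T - T') + norm (S' - S) * (1/2)"
    using mult_left_mono[OF small, of "norm (S' - S)"]
    by (simp add: algebra_simps power2_eq_square)
  finally show ?thesis by (simp add: algebra_simps)
qed

text \<open>A global form of the inverse function theorem. The derivative of the inverse at
  \<open>f x\<close> is the inverse of the derivative of \<open>f\<close> at \<open>x\<close>, so its continuity is continuity of inversion.\<close>
lemma C1_on_inv_into:
  fixes f :: "'a::euclidean_space \<Rightarrow> 'a"
  assumes "open U" and C1: "C1_on f U" and inj: "inj_on f U"
    and der_inj: "\<And>x D h. x \<in> U \<Longrightarrow> (f has_derivative D) (at x) \<Longrightarrow> D h = 0 \<Longrightarrow> h = 0"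
  shows "C1_on (inv_into U f) (f ` U)"
proof -
  let ?g = "inv_into U f"
  obtain f' where f': "\<And>x. x \<in> U \<Longrightarrow> (f has_derivative blinfun_apply (f' x)) (at x)"
    and cont: "continuous_on U f'"
    using C1 unfolding C1_on_def by blast
  have "\<exists>S. S o\<^sub>L f' x = id_blinfun \<and> f' x o\<^sub>L S = id_blinfun" if "x \<in> U" for x
  proof -
    have lin: "linear (blinfun_apply (f' x))"
      using blinfun.bounded_linear_right bounded_linear.linear by blast
    then have "inj (blinfun_apply (f' x))"
      using der_inj[OF that f'[OF that]] by (simp add: linear_injective_0)
    from linear_injective_isomorphism[OF lin this]
    obtain S where S: "linear S" "\<And>y. S (f' x y) = y" "\<And>y. f' x (S y) = y"
      by blast
    then have "blinfun_apply (Blinfun S) = S"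
      by (simp add: bounded_linear_Blinfun_apply linear_conv_bounded_linear)
    then have "Blinfun S o\<^sub>L f' x = id_blinfun" "f' x o\<^sub>L Blinfun S = id_blinfun"
      using S(2,3) by (intro blinfun_eqI; simp)+
    then show ?thesis by blast
  qed
  then obtain S where S1: "\<And>x. x \<in> U \<Longrightarrow> S x o\<^sub>L f' x = id_blinfun"
    and S2: "\<And>x. x \<in> U \<Longrightarrow> f' x o\<^sub>L S x = id_blinfun"
    by metis
  have der: "(?g has_derivative blinfun_apply (S x)) (at (f x))" if "x \<in> U" for x
  proof (rule has_derivative_inverse_strong[OF \<open>open U\<close> that])
    show "continuous_on U f" using C1 by (rule C1_on_continuous_on)
    show "?g (f y) = y" if "y \<in> U" for y using inj that by simp
    show "(f has_derivative blinfun_apply (f' x)) (at x)" using f' that .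
    show "blinfun_apply (f' x) \<circ> blinfun_apply (S x) = id"
      using arg_cong[OF S2[OF that], of blinfun_apply]
      by (simp only: blinfun_compose.rep_eq id_blinfun.rep_eq id_def)
  qed
  have contS: "continuous_on U S"
    unfolding continuous_on_def
  proof
    fix x assume x: "x \<in> U"
    have lim: "((\<lambda>y. norm (f' x - f' y)) \<longlongrightarrow> 0) (at x within U)"
    proof -
      have "((\<lambda>y. norm (f' x - f' y)) \<longlongrightarrow> norm (f' x - f' x)) (at x within U)"
        using cont x unfolding continuous_on_def by (intro tendsto_intros) auto
      then show ?thesis by simp
    qed
    have "((\<lambda>y. norm (S x) * norm (f' x - f' y)) \<longlongrightarrow> norm (S x) * 0) (at x within U)"
      by (intro tendsto_intros lim)
    then have "\<forall>\<^sub>F y in at x within U. norm (S x) * norm (f' x - f' y) < 1/2"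
      by (intro order_tendstoD) auto
    moreover have "\<forall>\<^sub>F y in at x within U. y \<in> U"
      by (simp add: eventually_at_filter)
    ultimately have "\<forall>\<^sub>F y in at x within U.
      norm (S y - S x) \<le> 2 * (norm (S x))\<^sup>2 * norm (f' x - f' y)"
      by eventually_elim (rule norm_inverse_blinfun_diff_le, use S1 S2 x in auto)
    moreover have "((\<lambda>y. 2 * (norm (S x))\<^sup>2 * norm (f' x - f' y)) \<longlongrightarrow> 2 * (norm (S x))\<^sup>2 * 0) (at x within U)"
      by (intro tendsto_intros lim)
    ultimately show "(S \<longlongrightarrow> S x) (at x within U)"
      by (intro LIM_zero_cancel[of S "S x"] Lim_null_comparison[of "\<lambda>y. S y - S x"]) auto
  qed
  have "continuous_on (f ` U) ?g"
    using has_derivative_continuous[OF der] by (auto intro!: continuous_at_imp_continuous_on simp del: inv_into_f_f)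
  then have "continuous_on (f ` U) (\<lambda>y. S (?g y))"
    by (rule continuous_on_compose2[OF contS]) (use inj in auto)
  then show ?thesis
    unfolding C1_on_def using der inj by (intro exI[of _ "\<lambda>y. S (?g y)"]) auto
qed

section \<open>Gronwall's inequality\<close>

text \<open>In an inner product space \<open>(norm (w r))\<^sup>2\<close> is differentiable, with derivative at most
  \<open>(2 N + 1) (norm (w r))\<^sup>2 + e\<^sup>2\<close>, and an integrating factor turns this differential inequality into
  monotonicity.\<close>
lemma gronwall_forward:
  fixes w :: "real \<Rightarrow> 'a::real_inner"
  assumes "s \<le> t" "0 \<le> e"
    and w': "\<And>r. s \<le> r \<Longrightarrow> r \<le> t \<Longrightarrow> (w has_vector_derivative w' r) (at r)"
    and bound: "\<And>r. s \<le> r \<Longrightarrow> r \<le> t \<Longrightarrow> norm (w' r) \<le> N * norm (w r) + e"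
    and "0 \<le> N"
  shows "(norm (w t))\<^sup>2 \<le> ((norm (w s))\<^sup>2 + e\<^sup>2 * (t - s)) * exp ((2 * N + 1) * (t - s))"
proof -
  define c where "c = 2 * N + 1"
  \<comment> \<open>The integrating factor, with the source term \<open>e\<^sup>2\<close> moved to the other side.\<close>
  define g where "g r = (w r \<bullet> w r) * exp (- c * (r - s)) - e\<^sup>2 * (r - s)" for r
  have "g t \<le> g s"
  proof (rule DERIV_nonpos_imp_nonincreasing[OF \<open>s \<le> t\<close>])
    fix r assume r: "s \<le> r" "r \<le> t"
    let ?D = "(2 * (w r \<bullet> w' r) - c * (w r \<bullet> w r)) * exp (- c * (r - s)) - e\<^sup>2"
    have "(w has_derivative (\<lambda>h. h *\<^sub>R w' r)) (at r)"
      using w'[OF r] by (simp add: has_vector_derivative_def)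
    from has_derivative_inner[OF this this]
    have "((\<lambda>r. w r \<bullet> w r) has_derivative (\<lambda>h. w r \<bullet> (h *\<^sub>R w' r) + (h *\<^sub>R w' r) \<bullet> w r)) (at r)" .
    moreover have "(\<lambda>h. w r \<bullet> (h *\<^sub>R w' r) + (h *\<^sub>R w' r) \<bullet> w r) = (*) (2 * (w r \<bullet> w' r))"
      by (simp add: fun_eq_iff inner_commute)
    ultimately have "((\<lambda>r. w r \<bullet> w r) has_real_derivative (2 * (w r \<bullet> w' r))) (at r)"
      by (simp only: has_field_derivative_def)
    moreover have "((\<lambda>r. exp (- c * (r - s))) has_real_derivative - c * exp (- c * (r - s))) (at r)"
      "((\<lambda>r. e\<^sup>2 * (r - s)) has_real_derivative e\<^sup>2) (at r)"
      by (auto intro!: derivative_eq_intros)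
    ultimately have "(g has_real_derivative 2 * (w r \<bullet> w' r) * exp (- c * (r - s))
        + - c * exp (- c * (r - s)) * (w r \<bullet> w r) - e\<^sup>2) (at r)"
      unfolding g_def by (intro DERIV_diff DERIV_mult)
    then have D: "(g has_real_derivative ?D) (at r)"
      by (simp add: algebra_simps)
    have "2 * (w r \<bullet> w' r) \<le> 2 * (norm (w r) * norm (w' r))"
      using norm_cauchy_schwarz[of "w r" "w' r"] by simp
    also have "\<dots> \<le> 2 * (norm (w r) * (N * norm (w r) + e))"
      using bound[OF r] by (simp add: mult_left_mono)
    also have "\<dots> \<le> c * (norm (w r))\<^sup>2 + e\<^sup>2"
      using sum_squares_bound[of "norm (w r)" e] by (simp add: c_def algebra_simps power2_eq_square)
    finally have "2 * (w r \<bullet> w' r) - c * (w r \<bullet> w r) \<le> e\<^sup>2"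
      by (simp add: power2_norm_eq_inner)
    then have "(2 * (w r \<bullet> w' r) - c * (w r \<bullet> w r)) * exp (- c * (r - s)) \<le> e\<^sup>2 * exp (- c * (r - s))"
      by (simp add: mult_right_mono)
    also have "\<dots> \<le> e\<^sup>2"
    proof -
      have "- c * (r - s) \<le> 0"
        using r \<open>0 \<le> N\<close> by (intro mult_nonpos_nonneg) (auto simp: c_def)
      then show ?thesis by (simp add: mult_left_le)
    qed
    finally show "\<exists>y. (g has_real_derivative y) (at r) \<and> y \<le> 0"
      using D by auto
  qed
  then have "(w t \<bullet> w t) * exp (- c * (t - s)) * exp (c * (t - s))
      \<le> (w s \<bullet> w s + e\<^sup>2 * (t - s)) * exp (c * (t - s))"
    unfolding g_def by (intro mult_right_mono) auto
  moreover have "exp (- c * (t - s)) * exp (c * (t - s)) = 1"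
    by (simp flip: exp_add)
  ultimately have "w t \<bullet> w t \<le> (w s \<bullet> w s + e\<^sup>2 * (t - s)) * exp (c * (t - s))"
    by (simp only: mult.assoc mult_1_right)
  then show ?thesis
    by (simp only: c_def power2_norm_eq_inner)
qed

text \<open>The bound is linear in \<open>norm (w s) + e\<close> with a factor that depends only on \<open>N\<close> and the elapsed
  time. This form serves uniqueness (both terms zero), Lipschitz dependence (\<open>e = 0\<close>) and
  the estimate of error terms (\<open>w s = 0\<close>) alike.\<close>
lemma gronwall:
  fixes w :: "real \<Rightarrow> 'a::real_inner"
  assumes w': "\<And>r. r \<in> closed_segment s t \<Longrightarrow> (w has_vector_derivative w' r) (at r)"
    and bound: "\<And>r. r \<in> closed_segment s t \<Longrightarrow> norm (w' r) \<le> N * norm (w r) + e"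
    and "0 \<le> N" "0 \<le> e"
  shows "norm (w t) \<le> (norm (w s) + e) * ((1 + \<bar>t - s\<bar>) * exp ((2 * N + 1) * \<bar>t - s\<bar>))"
proof -
  let ?d = "\<bar>t - s\<bar>" and ?E = "exp ((2 * N + 1) * \<bar>t - s\<bar>)"
  have "(norm (w t))\<^sup>2 \<le> ((norm (w s))\<^sup>2 + e\<^sup>2 * ?d) * ?E"
  proof (cases "s \<le> t")
    case True
    then show ?thesis
      using gronwall_forward[of s t e w w' N] assms by (simp add: closed_segment_eq_real_ivl)
  next
    case False
    \<comment> \<open>Reverse time.\<close>
    have "((\<lambda>r. w (- r)) has_vector_derivative - w' (- r)) (at r)" if "- s \<le> r" "r \<le> - t" for r
    proof -
      have "(w has_vector_derivative w' (- r)) (at (- r))"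
        using w'[of "- r"] that False by (simp add: closed_segment_eq_real_ivl)
      moreover have "((\<lambda>r. - r) has_vector_derivative -1) (at r)"
        by (auto intro!: derivative_eq_intros)
      ultimately show ?thesis
        using vector_diff_chain_at[of "\<lambda>r. - r" "-1" r w "w' (- r)"] by (simp add: o_def)
    qed
    with False show ?thesis
      using gronwall_forward[of "- s" "- t" e "\<lambda>r. w (- r)" "\<lambda>r. - w' (- r)" N] assms
      by (simp add: closed_segment_eq_real_ivl)
  qed
  also have "\<dots> \<le> ((norm (w s) + e)\<^sup>2 * (1 + ?d)\<^sup>2) * ?E\<^sup>2"
  proof (intro mult_mono)
    have "(norm (w s))\<^sup>2 + e\<^sup>2 * ?d \<le> ((norm (w s))\<^sup>2 + e\<^sup>2) * (1 + ?d)"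
      by (simp add: algebra_simps)
    also have "\<dots> \<le> (norm (w s) + e)\<^sup>2 * (1 + ?d)\<^sup>2"
      using \<open>0 \<le> e\<close> self_le_power[of "1 + ?d" 2]
      by (intro mult_mono) (auto simp: power2_sum)
    finally show "(norm (w s))\<^sup>2 + e\<^sup>2 * ?d \<le> (norm (w s) + e)\<^sup>2 * (1 + ?d)\<^sup>2" .
    have "1 \<le> ?E" using \<open>0 \<le> N\<close> by simp
    then show "?E \<le> ?E\<^sup>2" by (simp add: power2_eq_square)
  qed auto
  finally have "(norm (w t))\<^sup>2 \<le> ((norm (w s) + e) * ((1 + ?d) * ?E))\<^sup>2"
    by (simp add: power_mult_distrib)
  then show ?thesis
    by (rule power2_le_imp_le) (use \<open>0 \<le> e\<close> in auto)
qed

definition gronwall_factor :: "real \<Rightarrow> real \<Rightarrow> real" where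
  "gronwall_factor N d = (1 + d) * exp ((2 * N + 1) * d)"

lemma gronwall_factor_ge_1: "0 \<le> N \<Longrightarrow> 0 \<le> d \<Longrightarrow> 1 \<le> gronwall_factor N d"
  unfolding gronwall_factor_def using mult_mono[of 1 "1 + d" 1 "exp ((2 * N + 1) * d)"] by simp

lemma gronwall_factor_mono:
  assumes "0 \<le> N" "0 \<le> d" "d \<le> d'"
  shows "gronwall_factor N d \<le> gronwall_factor N d'"
  unfolding gronwall_factor_def using assms by (intro mult_mono) (auto intro!: mult_left_mono)

lemma gronwall_on_interval:
  fixes w :: "real \<Rightarrow> 'a::real_inner"
  assumes st: "s \<in> {a..b}" "t \<in> {a..b}"
    and w': "\<And>r. r \<in> {a..b} \<Longrightarrow> (w has_vector_derivative w' r) (at r)"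
    and bound: "\<And>r. r \<in> {a..b} \<Longrightarrow> norm (w' r) \<le> N * norm (w r) + e"
    and "0 \<le> N" "0 \<le> e"
  shows "norm (w t) \<le> (norm (w s) + e) * gronwall_factor N (b - a)"
proof -
  have "closed_segment s t \<subseteq> {a..b}"
    using st by (simp add: closed_segment_subset)
  then have "norm (w t) \<le> (norm (w s) + e) * gronwall_factor N \<bar>t - s\<bar>"
    unfolding gronwall_factor_def using assms(3-) by (intro gronwall[where w' = w']) auto
  also have "\<dots> \<le> (norm (w s) + e) * gronwall_factor N (b - a)"
    using assms by (intro mult_left_mono gronwall_factor_mono) auto
  finally show ?thesis .
qed

section \<open>Strictly differentiable families\<close>

lemma divide_norm_mult_less:
  fixes e :: real
  assumes "0 < e"
  shows "e / (norm h + 1) * norm h < e"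
proof -
  have "0 < norm h + 1" by (simp add: add_nonneg_pos)
  then show ?thesis using assms by (simp add: pos_divide_less_eq)
qed

text \<open>Assumption \<open>strict\<close> says that difference quotients of \<open>F (s, _)\<close> in a common direction
  \<open>a k = b l\<close> agree up to a small relative error, whatever their base points and step sizes,
  uniformly for \<open>(s, y)\<close> near \<open>(t, x)\<close>. Varying the step size makes the quotients Cauchy; varying the
  base point yields additivity of the limit and its continuity.\<close>
lemma C1_on_strictly_differentiable_family:
  fixes F :: "real \<times> 'a::euclidean_space \<Rightarrow> 'b::banach"
  assumes "open T" "open M"
    and dt: "\<And>t x. t \<in> T \<Longrightarrow> x \<in> M \<Longrightarrow> ((\<lambda>s. F (s, x)) has_vector_derivative V (t, x)) (at t)"
    and strict: "\<And>t x e. t \<in> T \<Longrightarrow> x \<in> M \<Longrightarrow> 0 < e \<Longrightarrow>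
      \<exists>d>0. \<forall>s y z k l a b. dist t s < d \<longrightarrow> dist x y < d \<longrightarrow> dist x (y + k) < d \<longrightarrow>
        dist x z < d \<longrightarrow> dist x (z + l) < d \<longrightarrow> a *\<^sub>R k = b *\<^sub>R l \<longrightarrow>
        norm (a *\<^sub>R (F (s, y + k) - F (s, y)) - b *\<^sub>R (F (s, z + l) - F (s, z))) \<le> e * norm (a *\<^sub>R k)"
  obtains X where "\<And>t x. t \<in> T \<Longrightarrow> x \<in> M \<Longrightarrow>
      (F has_derivative (\<lambda>(u, h). u *\<^sub>R V (t, x) + X (t, x) h)) (at (t, x))"
    and "\<And>h. continuous_on (T \<times> M) (\<lambda>p. X p h)"
    and "\<And>t x. t \<in> T \<Longrightarrow> x \<in> M \<Longrightarrow> ((\<lambda>y. F (t, y)) has_derivative X (t, x)) (at x)"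
proof -
  define Q where "Q t x h r = (F (t, x + r *\<^sub>R h) - F (t, x)) /\<^sub>R r" for t x h r
  have scale: "\<forall>\<^sub>F r in at 0. dist x (y + r *\<^sub>R k) < d" if "dist x y < d" for x y k :: 'a and d
  proof -
    have "((\<lambda>r. dist x (y + r *\<^sub>R k)) \<longlongrightarrow> dist x (y + 0 *\<^sub>R k)) (at 0)"
      by (intro tendsto_intros)
    then show ?thesis using that by (intro order_tendstoD) auto
  qed
  have nz: "\<forall>\<^sub>F r in at (0::real). r \<noteq> 0"
    by (simp add: eventually_at_filter)
  \<comment> \<open>The quotients converge, by the Cauchy criterion along \<open>1 / n\<close>.\<close>
  have "\<exists>L. (Q t x h \<longlongrightarrow> L) (at 0)" if tx: "t \<in> T" "x \<in> M" for t x h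
  proof -
    have close: "\<exists>\<delta>>0. \<forall>r r'. r \<noteq> 0 \<longrightarrow> r' \<noteq> 0 \<longrightarrow> \<bar>r\<bar> < \<delta> \<longrightarrow> \<bar>r'\<bar> < \<delta> \<longrightarrow> dist (Q t x h r) (Q t x h r') < e"
      if "0 < e" for e
    proof -
      define e' where "e' = e / (norm h + 1)"
      have "0 < e'" using that unfolding e'_def by (intro divide_pos_pos) (auto simp: add_nonneg_pos)
      from strict[OF tx this] obtain d where "d > 0" and
        d: "\<And>k l a b. dist x (x + k) < d \<Longrightarrow> dist x (x + l) < d \<Longrightarrow> a *\<^sub>R k = b *\<^sub>R l \<Longrightarrow>
        norm (a *\<^sub>R (F (t, x + k) - F (t, x)) - b *\<^sub>R (F (t, x + l) - F (t, x))) \<le> e' * norm (a *\<^sub>R k)"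
        by (metis dist_self)
      obtain \<delta> where "\<delta> > 0" and \<delta>: "\<And>r. r \<noteq> 0 \<Longrightarrow> \<bar>r\<bar> < \<delta> \<Longrightarrow> dist x (x + r *\<^sub>R h) < d"
        using scale[of x x d h] \<open>d > 0\<close> unfolding eventually_at by auto
      have "e' * norm h < e"
        unfolding e'_def using that by (rule divide_norm_mult_less)
      moreover have "dist (Q t x h r) (Q t x h r') \<le> e' * norm h"
        if "r \<noteq> 0" "r' \<noteq> 0" "\<bar>r\<bar> < \<delta>" "\<bar>r'\<bar> < \<delta>" for r r'
        using d[OF \<delta> \<delta>, of r r' "inverse r" "inverse r'"] that by (simp add: Q_def dist_norm)
      ultimately show ?thesis using \<open>\<delta> > 0\<close> by (meson le_less_trans)
    qed
    have "Cauchy (\<lambda>n. Q t x h (inverse (real (Suc n))))"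
    proof (rule metric_CauchyI)
      fix e :: real assume "0 < e"
      then obtain \<delta> where "\<delta> > 0" and \<delta>: "\<And>r r'. r \<noteq> 0 \<Longrightarrow> r' \<noteq> 0 \<Longrightarrow> \<bar>r\<bar> < \<delta> \<Longrightarrow> \<bar>r'\<bar> < \<delta> \<Longrightarrow>
        dist (Q t x h r) (Q t x h r') < e"
        using close by meson
      have "\<forall>\<^sub>F n in sequentially. inverse (real (Suc n)) < \<delta>"
        using LIMSEQ_inverse_real_of_nat \<open>\<delta> > 0\<close> by (rule order_tendstoD)
      then obtain m where "\<And>n. n \<ge> m \<Longrightarrow> inverse (real (Suc n)) < \<delta>"
        unfolding eventually_sequentially by blast
      then show "\<exists>M. \<forall>m\<ge>M. \<forall>n\<ge>M. dist (Q t x h (inverse (real (Suc m)))) (Q t x h (inverse (real (Suc n)))) < e"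
        by (intro exI[of _ m]) (auto intro!: \<delta>)
    qed
    then obtain L where L: "(\<lambda>n. Q t x h (inverse (real (Suc n)))) \<longlonglongrightarrow> L"
      using Cauchy_convergent convergent_def by blast
    have "(Q t x h \<longlongrightarrow> L) (at 0)"
    proof (rule tendstoI)
      fix e :: real assume "0 < e"
      then obtain \<delta> where "\<delta> > 0" and \<delta>: "\<And>r r'. r \<noteq> 0 \<Longrightarrow> r' \<noteq> 0 \<Longrightarrow> \<bar>r\<bar> < \<delta> \<Longrightarrow> \<bar>r'\<bar> < \<delta> \<Longrightarrow>
        dist (Q t x h r) (Q t x h r') < e / 2"
        using close[of "e / 2"] by (meson half_gt_zero)
      have "dist (Q t x h r) L < e" if "r \<noteq> 0" "\<bar>r\<bar> < \<delta>" for r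
      proof -
        have "\<forall>\<^sub>F n in sequentially. inverse (real (Suc n)) < \<delta>"
          using LIMSEQ_inverse_real_of_nat \<open>\<delta> > 0\<close> by (rule order_tendstoD)
        moreover have "\<forall>\<^sub>F n in sequentially. dist (Q t x h (inverse (real (Suc n)))) L < e / 2"
          using L \<open>0 < e\<close> by (intro tendstoD) auto
        ultimately have "\<forall>\<^sub>F n in sequentially. inverse (real (Suc n)) < \<delta> \<and> dist (Q t x h (inverse (real (Suc n)))) L < e / 2"
          by (rule eventually_conj)
        then obtain n where "inverse (real (Suc n)) < \<delta>" "dist (Q t x h (inverse (real (Suc n)))) L < e / 2"
          using eventually_happens by fastforce
        then show ?thesis
          using \<delta>[of r "inverse (real (Suc n))"] that
            dist_triangle[of "Q t x h r" L "Q t x h (inverse (real (Suc n)))"]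
          by fastforce
      qed
      then show "\<forall>\<^sub>F r in at 0. dist (Q t x h r) L < e"
        unfolding eventually_at using \<open>\<delta> > 0\<close> by auto
    qed
    then show ?thesis ..
  qed
  then obtain X0 where X0: "\<And>t x h. t \<in> T \<Longrightarrow> x \<in> M \<Longrightarrow> (Q t x h \<longlongrightarrow> X0 t x h) (at 0)"
    by metis
  define X where "X p h = X0 (fst p) (snd p) h" for p h
  have X: "\<And>t x h. t \<in> T \<Longrightarrow> x \<in> M \<Longrightarrow> (Q t x h \<longlongrightarrow> X (t, x) h) (at 0)"
    using X0 by (simp add: X_def)
  \<comment> \<open>One difference quotient in the strictness estimate passed to the limit.\<close>
  have X_approx: "\<exists>d>0. ball t d \<subseteq> T \<and> ball x d \<subseteq> M \<and> (\<forall>s y k z. dist t s < d \<longrightarrow> dist x y < d \<longrightarrow>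
      dist x (y + k) < d \<longrightarrow> dist x z < d \<longrightarrow>
      norm (F (s, y + k) - F (s, y) - X (s, z) k) \<le> e * norm k)"
    if tx: "t \<in> T" "x \<in> M" and "0 < e" for t x e
  proof -
    from strict[OF tx \<open>0 < e\<close>] obtain d0 where "d0 > 0" and d0: "\<And>s y z k l a b. dist t s < d0 \<Longrightarrow> dist x y < d0 \<Longrightarrow>
        dist x (y + k) < d0 \<Longrightarrow> dist x z < d0 \<Longrightarrow> dist x (z + l) < d0 \<Longrightarrow> a *\<^sub>R k = b *\<^sub>R l \<Longrightarrow>
        norm (a *\<^sub>R (F (s, y + k) - F (s, y)) - b *\<^sub>R (F (s, z + l) - F (s, z))) \<le> e * norm (a *\<^sub>R k)"
      by meson
    obtain d1 d2 where "d1 > 0" "ball t d1 \<subseteq> T" "d2 > 0" "ball x d2 \<subseteq> M"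
      using tx \<open>open T\<close> \<open>open M\<close> unfolding open_contains_ball by meson
    define d where "d = min d0 (min d1 d2)"
    have sub: "ball t d \<subseteq> T" "ball x d \<subseteq> M" "d > 0" "d \<le> d0"
      using \<open>d0 > 0\<close> \<open>d1 > 0\<close> \<open>ball t d1 \<subseteq> T\<close> \<open>d2 > 0\<close> \<open>ball x d2 \<subseteq> M\<close> by (auto simp: d_def subset_iff)
    show ?thesis
    proof (intro exI[of _ d] conjI allI impI sub)
      fix s y k z assume *: "dist t s < d" "dist x y < d" "dist x (y + k) < d" "dist x z < d"
      then have "s \<in> T" "z \<in> M" using sub by auto
      have "\<forall>\<^sub>F r in at 0. norm (F (s, y + k) - F (s, y) - Q s z k r) \<le> e * norm k"
        using scale[OF *(4), of k] nz
      proof eventually_elim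
        case (elim r)
        then show ?case
          using d0[of s y k z "r *\<^sub>R k" 1 "inverse r"] * sub by (simp add: Q_def)
      qed
      moreover have "((\<lambda>r. norm (F (s, y + k) - F (s, y) - Q s z k r)) \<longlongrightarrow>
          norm (F (s, y + k) - F (s, y) - X (s, z) k)) (at 0)"
        by (intro tendsto_intros X \<open>s \<in> T\<close> \<open>z \<in> M\<close>)
      ultimately show "norm (F (s, y + k) - F (s, y) - X (s, z) k) \<le> e * norm k"
        using tendsto_upperbound at_neq_bot by blast
    qed
  qed
  have X_linear: "linear (X (t, x))" if tx: "t \<in> T" "x \<in> M" for t x
  proof (rule linearI)
    fix h k
    \<comment> \<open>The increment along \<open>h + k\<close> is that along \<open>h\<close> followed by one along \<open>k\<close> from the base point
      \<open>x + r h\<close>; \<open>strict\<close> moves the latter back to \<open>x\<close>.\<close>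
    have *: "norm (X (t, x) (h + k) - X (t, x) h - X (t, x) k) \<le> e * norm k" if "0 < e" for e
    proof -
      from X_approx[OF tx \<open>0 < e\<close>] obtain d where "d > 0"
        and d: "\<And>y k. dist x y < d \<Longrightarrow> dist x (y + k) < d \<Longrightarrow>
        norm (F (t, y + k) - F (t, y) - X (t, x) k) \<le> e * norm k"
        by (metis dist_self)
      from strict[OF tx \<open>0 < e\<close>] obtain d0 where "d0 > 0" and d0: "\<And>y z k l a b. dist x y < d0 \<Longrightarrow>
        dist x (y + k) < d0 \<Longrightarrow> dist x z < d0 \<Longrightarrow> dist x (z + l) < d0 \<Longrightarrow> a *\<^sub>R k = b *\<^sub>R l \<Longrightarrow>
        norm (a *\<^sub>R (F (t, y + k) - F (t, y)) - b *\<^sub>R (F (t, z + l) - F (t, z))) \<le> e * norm (a *\<^sub>R k)"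
        by (metis dist_self)
      have 0: "dist x x < d0" using \<open>d0 > 0\<close> by simp
      have "\<forall>\<^sub>F r in at 0. norm (Q t x (h + k) r - Q t x h r - Q t x k r) \<le> e * norm k"
        using scale[OF 0, of h] scale[OF 0, of k] scale[OF 0, of "h + k"] nz
      proof eventually_elim
        case (elim r)
        have "Q t x (h + k) r - Q t x h r = inverse r *\<^sub>R (F (t, (x + r *\<^sub>R h) + r *\<^sub>R k) - F (t, x + r *\<^sub>R h))"
          by (simp add: Q_def algebra_simps)
        then show ?case
          using d0[of "x + r *\<^sub>R h" "r *\<^sub>R k" x "r *\<^sub>R k" "inverse r" "inverse r"] elim \<open>d0 > 0\<close>
          by (simp add: Q_def algebra_simps)
      qed
      moreover have "((\<lambda>r. norm (Q t x (h + k) r - Q t x h r - Q t x k r)) \<longlongrightarrow>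
          norm (X (t, x) (h + k) - X (t, x) h - X (t, x) k)) (at 0)"
        by (intro tendsto_intros X tx)
      ultimately show ?thesis
        using tendsto_upperbound at_neq_bot by blast
    qed
    have "norm (X (t, x) (h + k) - X (t, x) h - X (t, x) k) \<le> 0"
    proof (rule field_le_epsilon)
      fix e :: real assume "0 < e"
      have "norm (X (t, x) (h + k) - X (t, x) h - X (t, x) k) \<le> e / (norm k + 1) * norm k"
        using \<open>0 < e\<close> by (intro *) (auto intro!: divide_pos_pos simp: add_nonneg_pos)
      also have "\<dots> \<le> 0 + e" using divide_norm_mult_less[OF \<open>0 < e\<close>, of k] by simp
      finally show "norm (X (t, x) (h + k) - X (t, x) h - X (t, x) k) \<le> 0 + e" .
    qed
    then show "X (t, x) (h + k) = X (t, x) h + X (t, x) k" by (simp add: diff_eq_eq add.commute)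
  next
    fix c :: real and h
    show "X (t, x) (c *\<^sub>R h) = c *\<^sub>R X (t, x) h"
    proof (cases "c = 0")
      case True
      have "Q t x 0 = (\<lambda>_. 0)" by (simp add: Q_def fun_eq_iff)
      then have "(Q t x 0 \<longlongrightarrow> 0) (at 0)" by simp
      then have "X (t, x) 0 = 0" using X[OF tx, of 0] tendsto_unique at_neq_bot by blast
      then show ?thesis using True by simp
    next
      case False
      have "filterlim (\<lambda>r. c * r) (at 0) (at 0)"
        using False by (auto simp: filterlim_at eventually_at_filter intro!: tendsto_eq_intros)
      then have "((\<lambda>r. c *\<^sub>R Q t x h (c * r)) \<longlongrightarrow> c *\<^sub>R X (t, x) h) (at 0)"
        using X[OF tx, of h] by (intro tendsto_intros) (rule filterlim_compose)
      moreover have "c *\<^sub>R Q t x h (c * r) = Q t x (c *\<^sub>R h) r" for r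
        using False by (simp add: Q_def mult.commute)
      ultimately show ?thesis
        using X[OF tx, of "c *\<^sub>R h"] tendsto_unique at_neq_bot by fastforce
    qed
  qed
  have X_cont: "continuous (at (t, x) within T \<times> M) (\<lambda>p. X p h)" if tx: "t \<in> T" "x \<in> M" for t x h
    unfolding continuous_within
  proof (rule tendstoI)
    fix e :: real assume "0 < e"
    define e' where "e' = e / 3 / (norm h + 1)"
    have "0 < e'" using \<open>0 < e\<close> unfolding e'_def by (auto intro!: divide_pos_pos simp: add_nonneg_pos)
    have e': "e' * norm h < e / 3"
      unfolding e'_def using \<open>0 < e\<close> by (intro divide_norm_mult_less) simp
    from X_approx[OF tx \<open>0 < e'\<close>] obtain d where "d > 0" "ball t d \<subseteq> T" "ball x d \<subseteq> M"
      and d: "\<And>s k z. dist t s < d \<Longrightarrow> dist x (x + k) < d \<Longrightarrow> dist x z < d \<Longrightarrow>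
        norm (F (s, x + k) - F (s, x) - X (s, z) k) \<le> e' * norm k"
      by (metis dist_self)
    have "\<forall>\<^sub>F r in at 0. dist x (x + r *\<^sub>R h) < d \<and> r \<noteq> 0"
      using scale[of x x d h] nz \<open>d > 0\<close> by (auto intro: eventually_conj)
    then obtain r where r: "dist x (x + r *\<^sub>R h) < d" "r \<noteq> 0"
      using eventually_happens by fastforce
    \<comment> \<open>One fixed difference quotient, continuous in time, approximates the derivative at all nearby points.\<close>
    have Qd: "norm (Q s x h r - X (s, z) h) \<le> e' * norm h" if "dist t s < d" "dist x z < d" for s z
    proof -
      have sz: "s \<in> T" "z \<in> M" using that \<open>ball t d \<subseteq> T\<close> \<open>ball x d \<subseteq> M\<close> by auto
      have "Q s x h r - X (s, z) h = (F (s, x + r *\<^sub>R h) - F (s, x) - X (s, z) (r *\<^sub>R h)) /\<^sub>R r"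
        using r(2) by (simp add: Q_def linear_scale[OF X_linear[OF sz]] scaleR_diff_right)
      then have "norm (Q s x h r - X (s, z) h) = norm (F (s, x + r *\<^sub>R h) - F (s, x) - X (s, z) (r *\<^sub>R h)) / \<bar>r\<bar>"
        by (simp add: divide_inverse)
      also have "\<dots> \<le> e' * norm h"
        using d[OF that(1) r(1) that(2)] r(2) by (simp add: field_simps)
      finally show ?thesis .
    qed
    have "x + r *\<^sub>R h \<in> M" using r(1) \<open>ball x d \<subseteq> M\<close> by auto
    then have "isCont (\<lambda>s. Q s x h r) t"
      unfolding Q_def using dt[OF tx(1)] tx(2)
      by (intro continuous_intros) (auto intro: has_vector_derivative_continuous)
    then obtain d' where "d' > 0" and d': "\<And>s. dist s t < d' \<Longrightarrow> dist (Q s x h r) (Q t x h r) < e / 3"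
      using \<open>0 < e\<close> unfolding continuous_at_eps_delta by (metis divide_pos_pos zero_less_numeral)
    have "dist (X (s, y) h) (X (t, x) h) < e" if "dist (s, y) (t, x) < min d d'" for s y
    proof -
      have sy: "dist s t < min d d'" "dist y x < min d d'"
        using that dist_fst_le[of "(s, y)" "(t, x)"] dist_snd_le[of "(s, y)" "(t, x)"] by auto
      have "norm (Q s x h r - X (s, y) h) < e / 3" "norm (Q t x h r - X (t, x) h) < e / 3"
        using Qd[of s y] Qd[of t x] sy e' \<open>d > 0\<close> by (auto simp: dist_commute)
      moreover have "norm (Q s x h r - Q t x h r) < e / 3"
        using d' sy by (auto simp: dist_norm)
      ultimately show ?thesis
        unfolding dist_norm by norm
    qed
    then show "\<forall>\<^sub>F p in at (t, x) within T \<times> M. dist (X p h) (X (t, x) h) < e"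
      unfolding eventually_at using \<open>d > 0\<close> \<open>d' > 0\<close>
      by (intro exI[of _ "min d d'"]) auto
  qed
  have dx: "((\<lambda>y. F (t, y)) has_derivative X (t, x)) (at x)" if tx: "t \<in> T" "x \<in> M" for t x
    unfolding has_derivative_at_alt
  proof (intro conjI allI impI)
    show "bounded_linear (X (t, x))"
      using X_linear[OF tx] by (simp add: linear_conv_bounded_linear)
    fix e :: real assume "0 < e"
    from X_approx[OF tx this] obtain d where "d > 0"
      and d: "\<And>k. dist x (x + k) < d \<Longrightarrow> norm (F (t, x + k) - F (t, x) - X (t, x) k) \<le> e * norm k"
      by (metis dist_self)
    show "\<exists>d>0. \<forall>y. norm (y - x) < d \<longrightarrow> norm (F (t, y) - F (t, x) - X (t, x) (y - x)) \<le> e * norm (y - x)"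
      using d[of "y - x" for y] \<open>d > 0\<close> by (intro exI[of _ d]) (auto simp: dist_norm norm_minus_commute)
  qed
  have "(F has_derivative (\<lambda>(u, h). u *\<^sub>R V (t, x) + X (t, x) h)) (at (t, x))"
    if tx: "t \<in> T" "x \<in> M" for t x
  proof -
    obtain d where "d > 0" and sub: "ball x d \<subseteq> M"
      using tx \<open>open M\<close> unfolding open_contains_ball by meson
    have blin: "blinfun_apply (Blinfun (X p)) = X p" if "p \<in> T \<times> M" for p
      using that X_linear by (auto simp: bounded_linear_Blinfun_apply linear_conv_bounded_linear)
    have "((\<lambda>(s, y). F (s, y)) has_derivative (\<lambda>(u, h). u *\<^sub>R V (t, x) + Blinfun (X (t, x)) h))
      (at (t, x) within T \<times> ball x d)"
    proof (rule has_derivative_partialsI[where fy = "\<lambda>s y. Blinfun (X (s, y))"])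
      show "((\<lambda>s. F (s, x)) has_derivative (\<lambda>u. u *\<^sub>R V (t, x))) (at t within T)"
        using dt[OF tx] has_derivative_at_withinI unfolding has_vector_derivative_def by blast
      show "((\<lambda>y. F (s, y)) has_derivative blinfun_apply (Blinfun (X (s, y)))) (at y within ball x d)"
        if "s \<in> T" "y \<in> ball x d" for s y
      proof -
        have "y \<in> M" using that sub by auto
        then show ?thesis
          using dx[OF that(1)] blin[of "(s, y)"] that(1) has_derivative_at_withinI by fastforce
      qed
      have "continuous (at (t, x) within T \<times> ball x d) (\<lambda>p. Blinfun (X p))"
      proof (rule continuous_blinfun_componentwiseI1)
        fix i :: 'a
        have "continuous (at (t, x) within T \<times> ball x d) (\<lambda>p. X p i)"
          by (rule continuous_within_subset[OF X_cont[OF tx]]) (use sub in auto)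
        then show "continuous (at (t, x) within T \<times> ball x d) (\<lambda>p. blinfun_apply (Blinfun (X p)) i)"
          by (rule continuous_transform_within[OF _ zero_less_one])
            (use tx \<open>d > 0\<close> sub blin in auto)
      qed
      then show "continuous (at (t, x) within T \<times> ball x d) (\<lambda>(s, y). Blinfun (X (s, y)))"
        by (simp add: case_prod_beta')
    qed (use \<open>d > 0\<close> in auto)
    moreover have "at (t, x) within T \<times> ball x d = at (t, x)"
      using \<open>open T\<close> tx \<open>d > 0\<close> by (intro at_within_open open_Times) auto
    ultimately show ?thesis
      using blin[of "(t, x)"] tx by (simp add: case_prod_beta')
  qed
  moreover have "continuous_on (T \<times> M) (\<lambda>p. X p h)" for h
    using X_cont by (auto simp: continuous_on_eq_continuous_within)
  ultimately show ?thesis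
    using that dx by blast
qed

text \<open>Near a compact set the modulus of continuity of the derivative is uniform (a Lebesgue number of
  the cover by sets on which the derivative oscillates by at most \<open>e\<close>), and the mean value
  inequality turns it into a uniform linearization error.\<close>
lemma C1_on_uniformly_strictly_differentiable:
  fixes v :: "'a::real_normed_vector \<Rightarrow> 'b::real_normed_vector" and v' :: "'a \<Rightarrow> 'a \<Rightarrow>\<^sub>L 'b"
  assumes "open U" and v': "\<And>p. p \<in> U \<Longrightarrow> (v has_derivative blinfun_apply (v' p)) (at p)"
    and cont: "continuous_on U v'" and "compact K" "K \<subseteq> U" and "0 < e"
  obtains d where "0 < d" and "\<And>p. p \<in> K \<Longrightarrow> ball p d \<subseteq> U"
    and "\<And>p x y. p \<in> K \<Longrightarrow> x \<in> ball p d \<Longrightarrow> y \<in> ball p d \<Longrightarrow>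
      norm (v y - v x - v' p (y - x)) \<le> e * norm (y - x)"
proof -
  define \<G> where "\<G> = {G. open G \<and> G \<subseteq> U \<and> (\<forall>p\<in>G. \<forall>q\<in>G. norm (v' q - v' p) \<le> e)}"
  have "K \<subseteq> \<Union>\<G>"
  proof
    fix p assume "p \<in> K"
    then have "p \<in> U" using \<open>K \<subseteq> U\<close> by auto
    define G where "G = U \<inter> v' -` ball (v' p) (e / 2)"
    have "norm (v' q - v' q') \<le> e" if "q \<in> G" "q' \<in> G" for q q'
      using that dist_triangle_half_r[of "v' p" "v' q" e "v' q'"]
      by (auto simp: G_def dist_norm norm_minus_commute intro: less_imp_le)
    moreover have "open G"
      unfolding G_def by (intro continuous_open_preimage cont \<open>open U\<close> open_ball)
    ultimately have "G \<in> \<G>" by (auto simp: \<G>_def G_def)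
    moreover have "p \<in> G" using \<open>p \<in> U\<close> \<open>0 < e\<close> by (simp add: G_def)
    ultimately show "p \<in> \<Union>\<G>" by blast
  qed
  then obtain d where "0 < d" and d: "\<And>p. p \<in> K \<Longrightarrow> \<exists>G\<in>\<G>. ball p d \<subseteq> G"
    using Heine_Borel_lemma[OF \<open>compact K\<close>, of \<G>] \<G>_def by blast
  show ?thesis
  proof (rule that[OF \<open>0 < d\<close>])
    show "ball p d \<subseteq> U" if "p \<in> K" for p
      using d[OF that] unfolding \<G>_def by blast
    fix p x y assume p: "p \<in> K" and xy: "x \<in> ball p d" "y \<in> ball p d"
    obtain G where "G \<in> \<G>" and G: "ball p d \<subseteq> G"
      using d[OF p] by blast
    moreover have "p \<in> G" using G \<open>0 < d\<close> by auto
    ultimately have G: "ball p d \<subseteq> G" "G \<subseteq> U" "\<And>q. q \<in> G \<Longrightarrow> norm (v' q - v' p) \<le> e"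
      by (simp_all add: \<G>_def)
    have "norm (v y - v x - v' p (y - x)) \<le> norm (y - x) * e"
    proof (rule differentiable_bound_linearization[where S = "ball p d"])
      show "x + r *\<^sub>R (y - x) \<in> ball p d" if "r \<in> {0..1}" for r
        using convexD_alt[OF convex_ball xy, of r] that by (simp add: algebra_simps)
      show "(v has_derivative blinfun_apply (v' q)) (at q within ball p d)" if "q \<in> ball p d" for q
        using v'[of q] that G(1,2) has_derivative_at_withinI by blast
      show "onorm (blinfun_apply (v' q) - blinfun_apply (v' p)) \<le> e" if "q \<in> ball p d" for q
        using G(3)[of q] that G(1) by (auto simp: norm_blinfun.rep_eq minus_blinfun.rep_eq fun_diff_def)
    qed (use \<open>0 < d\<close> in auto)
    then show "norm (v y - v x - v' p (y - x)) \<le> e * norm (y - x)"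
      by (simp add: mult.commute)
  qed
qed

text \<open>If the derivative killed \<open>h\<close>, moving by a small multiple of \<open>h\<close> would change \<open>f\<close> by much less
  than the expansion bound demands.\<close>
lemma derivative_injective_if_expanding:
  fixes f :: "'a::real_normed_vector \<Rightarrow> 'b::real_normed_vector"
  assumes f': "(f has_derivative f') (at x)" and "open M" "x \<in> M"
    and expand: "\<And>y. y \<in> M \<Longrightarrow> norm (y - x) \<le> C * norm (f y - f x)" and "f' h = 0"
  shows "h = 0"
proof (rule ccontr)
  assume "h \<noteq> 0"
  \<comment> \<open>Small enough that \<open>C * e < 1\<close>.\<close>
  define e where "e = 1 / (2 * (\<bar>C\<bar> + 1))"
  have "0 < e" by (simp add: e_def)
  then obtain d where "0 < d" and
    d: "\<And>y. norm (y - x) < d \<Longrightarrow> norm (f y - f x - f' (y - x)) \<le> e * norm (y - x)"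
    using f' unfolding has_derivative_at_alt by blast
  obtain d' where "0 < d'" "ball x d' \<subseteq> M"
    using \<open>open M\<close> \<open>x \<in> M\<close> unfolding open_contains_ball by blast
  define r where "r = min d d' / (2 * norm h)"
  have r: "0 < r" "r * norm h < d" "r * norm h < d'"
    using \<open>0 < d\<close> \<open>0 < d'\<close> \<open>h \<noteq> 0\<close> by (auto simp: r_def min_def)
  let ?y = "x + r *\<^sub>R h"
  have "?y \<in> M"
    using r \<open>ball x d' \<subseteq> M\<close> by (auto simp: subset_iff dist_norm)
  have "f' (r *\<^sub>R h) = 0"
    using f' \<open>f' h = 0\<close> by (simp add: has_derivative_linear linear_scale)
  then have "norm (f ?y - f x) \<le> e * (r * norm h)"
    using d[of ?y] r by simp
  then have "\<bar>C\<bar> * norm (f ?y - f x) \<le> \<bar>C\<bar> * (e * (r * norm h))"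
    by (rule mult_left_mono) simp
  also have "\<dots> < r * norm h"
  proof -
    have "\<bar>C\<bar> * e < 1" by (simp add: e_def divide_simps)
    then show ?thesis
      using r(1) \<open>h \<noteq> 0\<close> mult_strict_right_mono[of "\<bar>C\<bar> * e" 1 "r * norm h"] by (simp add: mult.assoc)
  qed
  also have "\<dots> \<le> C * norm (f ?y - f x)"
    using expand[OF \<open>?y \<in> M\<close>] r(1) by simp
  also have "\<dots> \<le> \<bar>C\<bar> * norm (f ?y - f x)"
    by (intro mult_right_mono) auto
  finally show False by simp
qed

section \<open>The flow of an equation with global solutions\<close>

definition open_subintervals :: "real set \<Rightarrow> real set set" where
  "open_subintervals I = {J. J \<noteq> {} \<and> open J \<and> is_interval J \<and> J \<subseteq> I}"

text \<open>Assumption \<open>complete\<close> asks only for existence of global solutions; together with uniqueness,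
  which the Lipschitz condition provides, it makes every solution a restriction of a global one.\<close>
locale complete_ode =
  fixes I :: "real set" and M :: "'a::euclidean_space set" and v :: "real \<times> 'a \<Rightarrow> 'a" and L :: "real \<Rightarrow> real"
  assumes I_nonempty: "I \<noteq> {}" and open_I: "open I" and interval_I: "is_interval I"
    and open_M: "open M" and C1_v: "C1_on v (I \<times> M)" and cont_L: "continuous_on I L"
    and lipschitz: "\<And>t x y. t \<in> I \<Longrightarrow> x \<in> M \<Longrightarrow> y \<in> M \<Longrightarrow>
      norm (v (t, x) - v (t, y)) \<le> L t * norm (x - y)"
    and complete: "\<And>t x. t \<in> I \<Longrightarrow> x \<in> M \<Longrightarrow> \<exists>\<psi>. is_solution I M v I \<psi> \<and> \<psi> t = x"
begin

lemma compact_subinterval: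
  assumes "s \<in> I" "t \<in> I"
  obtains a b where "{a..b} \<subseteq> I" "s \<in> {a<..<b}" "t \<in> {a<..<b}"
proof -
  have "min s t \<in> I" "max s t \<in> I"
    using assms by (simp_all add: min_def max_def)
  then obtain r r' where r: "0 < r" "cball (min s t) r \<subseteq> I" "0 < r'" "cball (max s t) r' \<subseteq> I"
    using open_I unfolding open_contains_cball by blast
  have "min s t - r \<in> I" "max s t + r' \<in> I"
    using r by (auto simp: subset_iff dist_real_def)
  then have "{min s t - r..max s t + r'} \<subseteq> I"
    using interval_I unfolding is_interval_1 by (meson atLeastAtMost_iff subsetI)
  then show ?thesis
    using r by (intro that[of "min s t - r" "max s t + r'"]) auto
qed

lemma uniform_lipschitz:
  assumes "{a..b} \<subseteq> I"
  obtains N where "0 \<le> N" "\<And>t x y. t \<in> {a..b} \<Longrightarrow> x \<in> M \<Longrightarrow> y \<in> M \<Longrightarrow>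
      norm (v (t, x) - v (t, y)) \<le> N * norm (x - y)"
proof -
  have "compact (L ` {a..b})"
    using continuous_on_subset[OF cont_L assms] by (intro compact_continuous_image) auto
  then obtain N where N: "\<And>t. t \<in> {a..b} \<Longrightarrow> \<bar>L t\<bar> \<le> N"
    using compact_imp_bounded bounded_iff by (metis imageI real_norm_def)
  show ?thesis
  proof (rule that[of "max N 0"])
    fix t x y assume *: "t \<in> {a..b}" "x \<in> M" "y \<in> M"
    have "norm (v (t, x) - v (t, y)) \<le> L t * norm (x - y)"
      using * assms lipschitz by blast
    also have "\<dots> \<le> max N 0 * norm (x - y)"
      using N[OF *(1)] by (intro mult_right_mono) auto
    finally show "norm (v (t, x) - v (t, y)) \<le> max N 0 * norm (x - y)" .
  qed simp
qed

text \<open>As \<open>s\<close> and \<open>t\<close> may come in either order, this bounds both how fast solutions separate and how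
  fast they approach each other.\<close>
lemma solutions_spread_on_interval:
  assumes st: "s \<in> {a..b}" "t \<in> {a..b}" and sol: "is_solution I M v J \<phi>" "is_solution I M v J \<psi>"
    and J: "{a..b} \<subseteq> J" and "0 \<le> N"
    and lip: "\<And>t x y. t \<in> {a..b} \<Longrightarrow> x \<in> M \<Longrightarrow> y \<in> M \<Longrightarrow> norm (v (t, x) - v (t, y)) \<le> N * norm (x - y)"
  shows "norm (\<phi> t - \<psi> t) \<le> norm (\<phi> s - \<psi> s) * gronwall_factor N (b - a)"
proof -
  have "norm (\<phi> t - \<psi> t) \<le> (norm (\<phi> s - \<psi> s) + 0) * gronwall_factor N (b - a)"
  proof (rule gronwall_on_interval[OF st])
    fix r assume r: "r \<in> {a..b}"
    with J have "r \<in> J" by auto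
    then show "((\<lambda>r. \<phi> r - \<psi> r) has_vector_derivative v (r, \<phi> r) - v (r, \<psi> r)) (at r)"
      using sol unfolding is_solution_def by (intro has_vector_derivative_diff) auto
    show "norm (v (r, \<phi> r) - v (r, \<psi> r)) \<le> N * norm (\<phi> r - \<psi> r) + 0"
      using lip[OF r, of "\<phi> r" "\<psi> r"] sol \<open>r \<in> J\<close> unfolding is_solution_def by (auto simp: image_subset_iff)
  qed (use \<open>0 \<le> N\<close> in auto)
  then show ?thesis by simp
qed

lemma solution_unique:
  assumes sol: "is_solution I M v J \<phi>" "is_solution I M v J \<psi>" and "s \<in> J" "t \<in> J" "\<phi> s = \<psi> s"
  shows "\<phi> t = \<psi> t"
proof -
  have J: "is_interval J" "J \<subseteq> I" using sol unfolding is_solution_def by auto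
  have "min s t \<in> J" "max s t \<in> J"
    using \<open>s \<in> J\<close> \<open>t \<in> J\<close> by (simp_all add: min_def max_def)
  then have seg: "{min s t..max s t} \<subseteq> J"
    using J(1) unfolding is_interval_1 by (meson atLeastAtMost_iff subsetI)
  obtain N where "0 \<le> N" "\<And>r x y. r \<in> {min s t..max s t} \<Longrightarrow> x \<in> M \<Longrightarrow> y \<in> M \<Longrightarrow>
      norm (v (r, x) - v (r, y)) \<le> N * norm (x - y)"
    using uniform_lipschitz[OF order_trans[OF seg \<open>J \<subseteq> I\<close>]] by metis
  then have "norm (\<phi> t - \<psi> t) \<le> norm (\<phi> s - \<psi> s) * gronwall_factor N (max s t - min s t)"
    by (intro solutions_spread_on_interval[OF _ _ sol seg]) auto
  then show ?thesis using \<open>\<phi> s = \<psi> s\<close> by simp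
qed

lemma solution_subinterval:
  assumes "is_solution I M v J \<psi>" "K \<in> open_subintervals I" "K \<subseteq> J"
  shows "is_solution I M v K \<psi>"
  using assms C1_on_subset[of \<psi> J K]
  by (auto simp: is_solution_def open_subintervals_def image_subset_iff subset_iff)

definition base_time :: real where "base_time = (SOME t. t \<in> I)"

lemma base_time: "base_time \<in> I"
  unfolding base_time_def using I_nonempty by (simp add: some_in_eq)

text \<open>A definite choice of the solution on \<open>I\<close> with value \<open>x\<close> at the base time. Only its values at
  times in \<open>I\<close> matter, where it is unique.\<close>
definition flow :: "real \<times> 'a \<Rightarrow> 'a" where
  "flow p = (SOME \<psi>. is_solution I M v I \<psi> \<and> \<psi> base_time = snd p) (fst p)"

lemma flow:
  assumes "x \<in> M"
  shows flow_solution: "is_solution I M v I (\<lambda>t. flow (t, x))"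
    and flow_base_time: "flow (base_time, x) = x"
  using someI_ex[OF complete[OF base_time assms]] by (auto simp: flow_def)

lemma flow_in_M: "t \<in> I \<Longrightarrow> x \<in> M \<Longrightarrow> flow (t, x) \<in> M"
  using flow_solution unfolding is_solution_def by blast

lemma flow_has_vector_derivative:
  "t \<in> I \<Longrightarrow> x \<in> M \<Longrightarrow> ((\<lambda>t. flow (t, x)) has_vector_derivative v (t, flow (t, x))) (at t)"
  using flow_solution unfolding is_solution_def by blast

lemma flow_onto:
  assumes "t \<in> I" "y \<in> M"
  obtains x where "x \<in> M" "flow (t, x) = y"
proof -
  obtain \<psi> where \<psi>: "is_solution I M v I \<psi>" "\<psi> t = y"
    using complete assms by blast
  then have "\<psi> base_time \<in> M"
    using base_time unfolding is_solution_def by blast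
  then show ?thesis
    using that solution_unique[OF \<psi>(1) flow_solution base_time assms(1)] flow_base_time \<psi>(2) by metis
qed

lemma flow_inj:
  assumes "t \<in> I" "x \<in> M" "y \<in> M" "flow (t, x) = flow (t, y)"
  shows "x = y"
  using solution_unique[OF flow_solution flow_solution _ base_time, of x y t] assms flow_base_time by metis

text \<open>Let \<open>w\<close> be the combination of increments in question. It vanishes at the base time because
  \<open>a k = b l\<close>. Linearizing \<open>v\<close> along the trajectory of \<open>x\<close> gives \<open>w' = A w\<close> up to an error that is
  small relative to the increments, hence, by Lipschitz dependence, relative to \<open>a k\<close>. Gronwall's
  inequality finishes the estimate.\<close>
lemma flow_strictly_differentiable:
  assumes "t \<in> I" "x \<in> M" "0 < e"
  shows "\<exists>d>0. \<forall>s y z k l a b. dist t s < d \<longrightarrow> dist x y < d \<longrightarrow> dist x (y + k) < d \<longrightarrow>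
        dist x z < d \<longrightarrow> dist x (z + l) < d \<longrightarrow> a *\<^sub>R k = b *\<^sub>R l \<longrightarrow>
        norm (a *\<^sub>R (flow (s, y + k) - flow (s, y)) - b *\<^sub>R (flow (s, z + l) - flow (s, z)))
        \<le> e * norm (a *\<^sub>R k)"
proof -
  obtain \<alpha> \<beta> where ab: "{\<alpha>..\<beta>} \<subseteq> I" "t \<in> {\<alpha><..<\<beta>}" "base_time \<in> {\<alpha>..\<beta>}"
    using compact_subinterval[OF \<open>t \<in> I\<close> base_time] by (metis greaterThanLessThan_subseteq_atLeastAtMost_iff order_refl subsetD)
  obtain N where "0 \<le> N" and N: "\<And>r x y. r \<in> {\<alpha>..\<beta>} \<Longrightarrow> x \<in> M \<Longrightarrow> y \<in> M \<Longrightarrow>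
      norm (v (r, x) - v (r, y)) \<le> N * norm (x - y)"
    using uniform_lipschitz[OF ab(1)] by metis
  obtain v' where v': "\<And>p. p \<in> I \<times> M \<Longrightarrow> (v has_derivative blinfun_apply (v' p)) (at p)"
    and cont_v': "continuous_on (I \<times> M) v'"
    using C1_v unfolding C1_on_def by blast
  define K where "K = (\<lambda>r. (r, flow (r, x))) ` {\<alpha>..\<beta>}"
  have "K \<subseteq> I \<times> M"
    using ab(1) flow_in_M \<open>x \<in> M\<close> by (auto simp: K_def)
  have "continuous_on {\<alpha>..\<beta>} (\<lambda>r. flow (r, x))"
    using ab(1) flow_has_vector_derivative[OF _ \<open>x \<in> M\<close>]
    by (intro continuous_at_imp_continuous_on ballI has_vector_derivative_continuous) blast
  then have "compact K"
    unfolding K_def by (intro compact_continuous_image continuous_intros) auto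
  then have "compact (v' ` K)"
    using continuous_on_subset[OF cont_v' \<open>K \<subseteq> I \<times> M\<close>] by (intro compact_continuous_image)
  then obtain B where B: "\<And>p. p \<in> K \<Longrightarrow> norm (v' p) \<le> B"
    using compact_imp_bounded[of "v' ` K"] unfolding bounded_iff by auto
  have "(t, flow (t, x)) \<in> K" using ab(2) by (auto simp: K_def)
  then have "0 \<le> B" using B norm_ge_zero order_trans by blast
  define C where "C = gronwall_factor N (\<beta> - \<alpha>)"
  define D where "D = gronwall_factor B (\<beta> - \<alpha>)"
  have CD: "1 \<le> C" "1 \<le> D"
    using \<open>0 \<le> N\<close> \<open>0 \<le> B\<close> ab(2) by (auto simp: C_def D_def intro: gronwall_factor_ge_1)
  \<comment> \<open>Two increments, each growing by \<open>C\<close>, enter the error term, which Gronwall multiplies by \<open>D\<close>.\<close>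
  define e' where "e' = e / (2 * C * D)"
  have "0 < e'" using \<open>0 < e\<close> CD by (simp add: e'_def)
  obtain \<delta> where "0 < \<delta>" and
    \<delta>: "\<And>p x y. p \<in> K \<Longrightarrow> x \<in> ball p \<delta> \<Longrightarrow> y \<in> ball p \<delta> \<Longrightarrow> norm (v y - v x - v' p (y - x)) \<le> e' * norm (y - x)"
    using C1_on_uniformly_strictly_differentiable[OF open_Times[OF open_I open_M] _ cont_v'
        \<open>compact K\<close> \<open>K \<subseteq> I \<times> M\<close> \<open>0 < e'\<close>, of v] v' by metis
  obtain d1 where "0 < d1" "ball t d1 \<subseteq> {\<alpha><..<\<beta>}"
    using ab(2) open_contains_ball[of "{\<alpha><..<\<beta>}"] by (metis open_greaterThanLessThan)
  obtain d2 where "0 < d2" "ball x d2 \<subseteq> M"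
    using \<open>x \<in> M\<close> open_M open_contains_ball[of M] by metis
  \<comment> \<open>Trajectories spread by at most the factor \<open>C\<close>, so starting within \<open>\<delta> / C\<close> keeps them within \<open>\<delta>\<close>.\<close>
  define d where "d = min d1 (min d2 (\<delta> / C))"
  have "0 < d" using \<open>0 < d1\<close> \<open>0 < d2\<close> \<open>0 < \<delta>\<close> CD by (simp add: d_def)
  have near_M: "y \<in> M" if "dist x y < d" for y
    using that \<open>ball x d2 \<subseteq> M\<close> by (auto simp: d_def subset_iff)
  have spread: "norm (flow (r, y) - flow (r, z)) \<le> C * norm (y - z)"
    if "r \<in> {\<alpha>..\<beta>}" "y \<in> M" "z \<in> M" for r y z
    using solutions_spread_on_interval[OF ab(3) that(1) flow_solution[OF that(2)] flow_solution[OF that(3)] ab(1) \<open>0 \<le> N\<close> N]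
      flow_base_time that by (simp add: C_def mult.commute)
  have near_K: "(r, flow (r, y)) \<in> ball (r, flow (r, x)) \<delta>" if "r \<in> {\<alpha>..\<beta>}" "dist x y < d" for r y
  proof -
    have "norm (flow (r, x) - flow (r, y)) \<le> C * norm (x - y)"
      using spread that near_M \<open>x \<in> M\<close> by blast
    also have "\<dots> < \<delta>"
      using that CD by (simp add: d_def dist_norm field_simps)
    finally show ?thesis by (simp add: dist_Pair_Pair dist_norm)
  qed
  define A where "A r h = v' (r, flow (r, x)) (0, h)" for r h
  have linearized: "norm (v (r, flow (r, y + k)) - v (r, flow (r, y)) - A r (flow (r, y + k) - flow (r, y)))
      \<le> e' * C * norm k" if "r \<in> {\<alpha>..\<beta>}" "dist x y < d" "dist x (y + k) < d" for r y k
  proof -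
    have "norm (v (r, flow (r, y + k)) - v (r, flow (r, y)) - A r (flow (r, y + k) - flow (r, y)))
      \<le> e' * norm (flow (r, y + k) - flow (r, y))"
      using \<delta>[of "(r, flow (r, x))" "(r, flow (r, y))" "(r, flow (r, y + k))"]
        near_K[OF that(1,2)] near_K[OF that(1,3)] that(1)
      by (simp add: A_def K_def norm_Pair)
    also have "\<dots> \<le> e' * (C * norm k)"
      using spread[OF that(1) near_M near_M, of "y + k" y] that \<open>0 < e'\<close> by (intro mult_left_mono) auto
    finally show ?thesis by simp
  qed
  have "norm (a *\<^sub>R (flow (s, y + k) - flow (s, y)) - b *\<^sub>R (flow (s, z + l) - flow (s, z)))
        \<le> e * norm (a *\<^sub>R k)"
    if s: "dist t s < d" and y: "dist x y < d" "dist x (y + k) < d" and z: "dist x z < d" "dist x (z + l) < d"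
      and eq: "a *\<^sub>R k = b *\<^sub>R l" for s y z k l a b
  proof -
    have "s \<in> {\<alpha><..<\<beta>}" using s \<open>ball t d1 \<subseteq> {\<alpha><..<\<beta>}\<close> by (auto simp: d_def subset_iff)
    then have s_ab: "s \<in> {\<alpha>..\<beta>}" by auto
    define w where "w r = a *\<^sub>R (flow (r, y + k) - flow (r, y)) - b *\<^sub>R (flow (r, z + l) - flow (r, z))" for r
    define w' where "w' r = a *\<^sub>R (v (r, flow (r, y + k)) - v (r, flow (r, y)))
      - b *\<^sub>R (v (r, flow (r, z + l)) - v (r, flow (r, z)))" for r
    have "norm (w s) \<le> (norm (w base_time) + 2 * e' * C * norm (a *\<^sub>R k)) * D"
      unfolding D_def
    proof (rule gronwall_on_interval[OF ab(3) s_ab])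
      fix r assume r: "r \<in> {\<alpha>..\<beta>}"
      then have "r \<in> I" using ab(1) by blast
      show "(w has_vector_derivative w' r) (at r)"
        unfolding w_def w'_def using near_M y z \<open>r \<in> I\<close>
        by (intro has_vector_derivative_diff bounded_linear.has_vector_derivative[OF bounded_linear_scaleR_right]
            flow_has_vector_derivative) auto
      let ?R = "\<lambda>y k. v (r, flow (r, y + k)) - v (r, flow (r, y)) - A r (flow (r, y + k) - flow (r, y))"
      have scl: "A r (c *\<^sub>R h) = c *\<^sub>R A r h" for c h
        by (simp add: A_def flip: blinfun.scaleR_right)
      have dff: "A r (h - h') = A r h - A r h'" for h h'
        by (simp add: A_def flip: blinfun.diff_right)
      have w'_eq: "w' r = A r (w r) + (a *\<^sub>R ?R y k - b *\<^sub>R ?R z l)"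
        unfolding w_def w'_def dff scl by (simp add: algebra_simps)
      have "norm (w' r) \<le> norm (A r (w r)) + (norm (a *\<^sub>R ?R y k) + norm (b *\<^sub>R ?R z l))"
        unfolding w'_eq by (rule order_trans[OF norm_triangle_ineq add_left_mono[OF norm_triangle_ineq4]])
      also have "\<dots> \<le> B * norm (w r) + (\<bar>a\<bar> * (e' * C * norm k) + \<bar>b\<bar> * (e' * C * norm l))"
      proof (intro add_mono)
        have "norm (A r (w r)) \<le> norm (v' (r, flow (r, x))) * norm (w r)"
          using norm_blinfun[of "v' (r, flow (r, x))" "(0, w r)"] by (simp add: A_def norm_Pair)
        also have "\<dots> \<le> B * norm (w r)"
          using r by (intro mult_right_mono B) (auto simp: K_def)
        finally show "norm (A r (w r)) \<le> B * norm (w r)" .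
        show "norm (a *\<^sub>R ?R y k) \<le> \<bar>a\<bar> * (e' * C * norm k)"
          using linearized[OF r y] by (simp add: mult_left_mono)
        show "norm (b *\<^sub>R ?R z l) \<le> \<bar>b\<bar> * (e' * C * norm l)"
          using linearized[OF r z] by (simp add: mult_left_mono)
      qed
      also have "\<bar>a\<bar> * (e' * C * norm k) + \<bar>b\<bar> * (e' * C * norm l) = e' * C * (norm (a *\<^sub>R k) + norm (b *\<^sub>R l))"
        by (simp add: algebra_simps)
      also have "\<dots> = 2 * e' * C * norm (a *\<^sub>R k)" by (simp add: eq)
      finally show "norm (w' r) \<le> B * norm (w r) + 2 * e' * C * norm (a *\<^sub>R k)" .
    qed (use \<open>0 \<le> B\<close> \<open>0 < e'\<close> CD in auto)
    moreover have "w base_time = 0"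
      using flow_base_time near_M y z eq by (simp add: w_def)
    ultimately show ?thesis
      using CD by (simp add: w_def e'_def)
  qed
  then show ?thesis using \<open>0 < d\<close> by blast
qed

lemma flow_derivative:
  obtains X where "\<And>t x. t \<in> I \<Longrightarrow> x \<in> M \<Longrightarrow>
      (flow has_derivative (\<lambda>(u, h). u *\<^sub>R v (t, flow (t, x)) + X (t, x) h)) (at (t, x))"
    and "\<And>h. continuous_on (I \<times> M) (\<lambda>p. X p h)"
    and "\<And>t x. t \<in> I \<Longrightarrow> x \<in> M \<Longrightarrow> ((\<lambda>y. flow (t, y)) has_derivative X (t, x)) (at x)"
  using C1_on_strictly_differentiable_family[OF open_I open_M, of flow "\<lambda>p. v (fst p, flow p)"]
    flow_has_vector_derivative flow_strictly_differentiable by auto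

lemma C1_flow: "C1_on flow (I \<times> M)"
proof -
  obtain X where X: "\<And>t x. t \<in> I \<Longrightarrow> x \<in> M \<Longrightarrow>
      (flow has_derivative (\<lambda>(u, h). u *\<^sub>R v (t, flow (t, x)) + X (t, x) h)) (at (t, x))"
    and cont: "\<And>h. continuous_on (I \<times> M) (\<lambda>p. X p h)"
    using flow_derivative by metis
  have "continuous_on (I \<times> M) flow"
    using X by (intro continuous_at_imp_continuous_on) (auto intro: has_derivative_continuous)
  then have "continuous_on (I \<times> M) (\<lambda>p. v (fst p, flow p))"
    using flow_in_M by (intro continuous_on_compose2[OF C1_on_continuous_on[OF C1_v]] continuous_intros) auto
  then have "continuous_on (I \<times> M) (\<lambda>p. fst h *\<^sub>R v (fst p, flow p) + X p (snd h))" for h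
    by (intro continuous_intros cont)
  then show ?thesis
    unfolding C1_on_componentwise using X
    by (intro exI[of _ "\<lambda>p h. fst h *\<^sub>R v (fst p, flow p) + X p (snd h)"]) (auto simp: case_prod_beta')
qed

text \<open>Gronwall's inequality run from \<open>t\<close> back to the base time bounds the distance of initial values by
  the distance at time \<open>t\<close>.\<close>
lemma flow_derivative_injective:
  assumes "t \<in> I" "x \<in> M" and D: "((\<lambda>y. flow (t, y)) has_derivative D) (at x)" and "D h = 0"
  shows "h = 0"
proof -
  obtain a b where ab: "{a..b} \<subseteq> I" "t \<in> {a..b}" "base_time \<in> {a..b}"
    using compact_subinterval[OF \<open>t \<in> I\<close> base_time] by (metis greaterThanLessThan_subseteq_atLeastAtMost_iff order_refl subsetD)
  obtain N where "0 \<le> N" and N: "\<And>r x y. r \<in> {a..b} \<Longrightarrow> x \<in> M \<Longrightarrow> y \<in> M \<Longrightarrow>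
      norm (v (r, x) - v (r, y)) \<le> N * norm (x - y)"
    using uniform_lipschitz[OF ab(1)] by metis
  show ?thesis
  proof (rule derivative_injective_if_expanding[OF D open_M \<open>x \<in> M\<close> _ \<open>D h = 0\<close>])
    fix y assume "y \<in> M"
    then show "norm (y - x) \<le> gronwall_factor N (b - a) * norm (flow (t, y) - flow (t, x))"
      using solutions_spread_on_interval[OF ab(2,3) flow_solution flow_solution ab(1) \<open>0 \<le> N\<close> N, of y x]
        flow_base_time \<open>x \<in> M\<close> by (simp add: mult.commute)
  qed
qed

end

section \<open>Diffeomorphism groups\<close>

lemma SYM_carrier:
  "g \<in> carrier (SYM X) \<longleftrightarrow> g \<in> Bij X \<and> C1_on g X \<and> C1_on (inv_into X g) X"
  by (simp add: SYM_def)

lemma SYM_C1: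
  assumes "g \<in> carrier (SYM X)"
  shows "C1_on g X" "C1_on (inv_into X g) X"
  using assms by (simp_all add: SYM_carrier)

lemma Bij_imp_bij_betw: "g \<in> Bij X \<Longrightarrow> bij_betw g X X"
  by (simp add: Bij_def)

lemma SYM_mem: "g \<in> carrier (SYM X) \<Longrightarrow> x \<in> X \<Longrightarrow> g x \<in> X"
  using SYM_carrier Bij_imp_bij_betw bij_betwE by metis

lemma SYM_inv_into_mem: "g \<in> carrier (SYM X) \<Longrightarrow> x \<in> X \<Longrightarrow> inv_into X g x \<in> X"
  using SYM_carrier Bij_inv_into_mem by metis

lemma SYM_inv_into:
  assumes "g \<in> carrier (SYM X)" "x \<in> X"
  shows "inv_into X g (g x) = x" "g (inv_into X g x) = x"
proof -
  have "bij_betw g X X" using assms(1) SYM_carrier Bij_imp_bij_betw by metis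
  then show "inv_into X g (g x) = x" "g (inv_into X g x) = x"
    using assms(2) by (simp_all add: bij_betw_inv_into_left bij_betw_inv_into_right)
qed

lemma SYM_memI:
  assumes "open X" "g \<in> extensional X" "C1_on g X" "C1_on k X"
    and "\<And>x. x \<in> X \<Longrightarrow> g x \<in> X" "\<And>x. x \<in> X \<Longrightarrow> k x \<in> X"
    and "\<And>x. x \<in> X \<Longrightarrow> k (g x) = x" "\<And>x. x \<in> X \<Longrightarrow> g (k x) = x"
  shows "g \<in> carrier (SYM X)"
proof -
  have bij: "bij_betw g X X"
    by (rule bij_betwI[of _ _ _ k]) (use assms in auto)
  have inv: "inv_into X g x = k x" if "x \<in> X" for x
    using bij_betw_inv_into_left[OF bij, of "k x"] assms that by simp
  have "C1_on (inv_into X g) X"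
    using C1_on_cong[OF assms(1), of "inv_into X g" k] inv assms(4) by blast
  then show ?thesis
    using bij assms by (simp add: SYM_carrier Bij_def)
qed

lemma SYM_mult:
  "f \<in> carrier (SYM X) \<Longrightarrow> g \<in> carrier (SYM X) \<Longrightarrow> f \<otimes>\<^bsub>SYM X\<^esub> g = compose X f g"
  by (simp add: SYM_def BijGroup_def)

lemma SYM_one: "\<one>\<^bsub>SYM X\<^esub> = (\<lambda>x\<in>X. x)"
  by (simp add: SYM_def BijGroup_def)

lemma group_SYM:
  assumes "open X"
  shows "group (SYM X)"
proof -
  let ?C = "carrier (SYM X)"
  have "subgroup ?C (BijGroup X)"
  proof (rule group.subgroupI[OF group_BijGroup])
    show "?C \<subseteq> carrier (BijGroup X)"
      by (auto simp: SYM_carrier BijGroup_def)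
    have "(\<lambda>x\<in>X. x) \<in> ?C"
      by (rule SYM_memI[OF assms, where k = "\<lambda>x. x"])
        (auto intro: C1_on_id C1_on_cong[OF assms, THEN iffD2])
    then show "?C \<noteq> {}" by blast
  next
    fix g assume g: "g \<in> ?C"
    have "restrict (inv_into X g) X \<in> ?C"
    proof (rule SYM_memI[OF assms, where k = g])
      have "C1_on (inv_into X g) X" using g by (simp add: SYM_carrier)
      then show "C1_on (restrict (inv_into X g) X) X"
        using C1_on_cong[OF assms, of "restrict (inv_into X g) X" "inv_into X g"] by simp
      show "C1_on g X" using g by (simp add: SYM_carrier)
    qed (simp_all add: g SYM_mem SYM_inv_into_mem SYM_inv_into)
    then show "inv\<^bsub>BijGroup X\<^esub> g \<in> ?C"
      using g by (simp add: SYM_carrier inv_BijGroup)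
  next
    fix f g assume fg: "f \<in> ?C" "g \<in> ?C"
    have "compose X f g \<in> ?C"
    proof (rule SYM_memI[OF assms, where k = "\<lambda>x. inv_into X g (inv_into X f x)"])
      have "C1_on (\<lambda>x. f (g x)) X"
        by (rule C1_on_compose[OF SYM_C1(1)[OF fg(1)] SYM_C1(1)[OF fg(2)]])
          (use SYM_mem[OF fg(2)] in blast)
      then show "C1_on (compose X f g) X"
        using C1_on_cong[OF assms, of "compose X f g" "\<lambda>x. f (g x)"] by (simp add: compose_eq)
      show "C1_on (\<lambda>x. inv_into X g (inv_into X f x)) X"
        by (rule C1_on_compose[OF SYM_C1(2)[OF fg(2)] SYM_C1(2)[OF fg(1)]])
          (use SYM_inv_into_mem[OF fg(1)] in blast)
    qed (simp_all add: fg compose_eq SYM_mem SYM_inv_into_mem SYM_inv_into)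
    then show "f \<otimes>\<^bsub>BijGroup X\<^esub> g \<in> ?C"
      using fg by (simp add: SYM_carrier BijGroup_def)
  qed
  from subgroup.subgroup_is_group[OF this group_BijGroup] show ?thesis
    by (simp add: SYM_def)
qed

lemma SYM_inv:
  assumes "open X" "g \<in> carrier (SYM X)"
  shows "inv\<^bsub>SYM X\<^esub> g \<in> carrier (SYM X)" and "\<And>x. x \<in> X \<Longrightarrow> (inv\<^bsub>SYM X\<^esub> g) x = inv_into X g x"
proof -
  interpret group "SYM X" by (rule group_SYM[OF assms(1)])
  show inv: "inv\<^bsub>SYM X\<^esub> g \<in> carrier (SYM X)" using assms by simp
  fix x assume x: "x \<in> X"
  have "compose X g (inv\<^bsub>SYM X\<^esub> g) = (\<lambda>x\<in>X. x)"
    using assms inv SYM_mult[of g X "inv\<^bsub>SYM X\<^esub> g"] by (simp add: SYM_one)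
  from fun_cong[OF this, of x] have "g ((inv\<^bsub>SYM X\<^esub> g) x) = x"
    using x by (simp add: compose_eq)
  then show "(inv\<^bsub>SYM X\<^esub> g) x = inv_into X g x"
    using SYM_inv_into(1)[OF assms(2) SYM_mem[OF inv x]] by simp
qed

lemma SYM_derivative_injective:
  assumes "open X" "g \<in> carrier (SYM X)" "x \<in> X" "(g has_derivative D) (at x)" "D h = 0"
  shows "h = 0"
proof -
  have "C1_on (inv_into X g) X" using assms(2) by (simp add: SYM_carrier)
  then obtain k' where "(inv_into X g has_derivative k') (at (g x))"
    using SYM_mem[OF assms(2,3)] unfolding C1_on_def by blast
  then show ?thesis
    by (rule derivative_injective_if_left_inverse[OF assms(4) _ assms(1,3) _ assms(5)])
      (simp add: SYM_inv_into(1)[OF assms(2)])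
qed

text \<open>The form in which the smoothness of an inverse comes for free: an injective derivative suffices.\<close>
lemma SYM_memI_derivative:
  fixes g :: "'a::euclidean_space \<Rightarrow> 'a"
  assumes "open X" "g \<in> extensional X" "bij_betw g X X" "C1_on g X"
    and "\<And>x D h. x \<in> X \<Longrightarrow> (g has_derivative D) (at x) \<Longrightarrow> D h = 0 \<Longrightarrow> h = 0"
  shows "g \<in> carrier (SYM X)"
  using C1_on_inv_into[OF assms(1,4) bij_betw_imp_inj_on[OF assms(3)] assms(5)] assms
  by (simp add: SYM_carrier Bij_def bij_betw_imp_surj_on)

text \<open>The image is open as the preimage under the continuous inverse, and connected as an image.\<close>
lemma SYM_image_open_subinterval:
  assumes "open I" "f \<in> carrier (SYM I)" "J \<in> open_subintervals I"
  shows "f ` J \<in> open_subintervals I"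
proof -
  have J: "J \<noteq> {}" "open J" "is_interval J" "J \<subseteq> I"
    using assms(3) by (auto simp: open_subintervals_def)
  have "f ` J = I \<inter> inv_into I f -` J"
  proof (intro equalityI subsetI)
    fix y assume "y \<in> f ` J"
    then obtain t where "t \<in> J" "y = f t" by blast
    then show "y \<in> I \<inter> inv_into I f -` J"
      using J(4) SYM_mem[OF assms(2)] SYM_inv_into(1)[OF assms(2)] by auto
  next
    fix y assume "y \<in> I \<inter> inv_into I f -` J"
    then show "y \<in> f ` J"
      using SYM_inv_into(2)[OF assms(2)] by force
  qed
  moreover have "continuous_on I (inv_into I f)"
    using C1_on_continuous_on[OF SYM_C1(2)[OF assms(2)]] .
  ultimately have "open (f ` J)"
    using continuous_open_preimage[OF _ assms(1) J(2)] by metis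
  moreover have "connected (f ` J)"
    using continuous_on_subset[OF C1_on_continuous_on[OF SYM_C1(1)[OF assms(2)]] J(4)] J(3)
    unfolding is_interval_connected_1 by (rule connected_continuous_image)
  ultimately show ?thesis
    using J(1,4) SYM_mem[OF assms(2)]
    unfolding open_subintervals_def is_interval_connected_1 by blast
qed

lemma SYM_mult_image:
  assumes "f \<in> carrier (SYM X)" "g \<in> carrier (SYM X)" "S \<subseteq> X"
  shows "(f \<otimes>\<^bsub>SYM X\<^esub> g) ` S = f ` (g ` S)"
proof -
  have "(f \<otimes>\<^bsub>SYM X\<^esub> g) s = f (g s)" if "s \<in> S" for s
    using that assms by (simp add: SYM_mult compose_eq subset_iff)
  then show ?thesis by (simp add: image_image)
qed

lemma SYM_inv_image:
  assumes "open X" "f \<in> carrier (SYM X)" "S \<subseteq> X"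
  shows "(inv\<^bsub>SYM X\<^esub> f) ` (f ` S) = S" "f ` ((inv\<^bsub>SYM X\<^esub> f) ` S) = S"
proof -
  have "(inv\<^bsub>SYM X\<^esub> f) (f s) = s" "f ((inv\<^bsub>SYM X\<^esub> f) s) = s" if "s \<in> S" for s
    using that assms(3) SYM_inv(2)[OF assms(1,2)] SYM_inv_into[OF assms(2)] SYM_mem[OF assms(2)]
    by (simp_all add: subset_iff)
  then show "(inv\<^bsub>SYM X\<^esub> f) ` (f ` S) = S" "f ` ((inv\<^bsub>SYM X\<^esub> f) ` S) = S"
    by (simp_all add: image_image)
qed

section \<open>Straightening the solutions\<close>

definition (in complete_ode) straightening :: "real \<times> 'a \<Rightarrow> real \<times> 'a" where
  "straightening = (\<lambda>p\<in>I \<times> M. (fst p, flow p))"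

text \<open>Every point lies on exactly one global solution, which makes the map bijective. Its derivative
  preserves the time component, so on the kernel only the spatial derivative of the flow acts, and
  that is injective.\<close>
lemma (in complete_ode) straightening_in_SYM: "straightening \<in> carrier (SYM (I \<times> M))"
proof (rule SYM_memI_derivative)
  show "open (I \<times> M)" using open_I open_M by (rule open_Times)
  show "straightening \<in> extensional (I \<times> M)" by (simp add: straightening_def)
  show "bij_betw straightening (I \<times> M) (I \<times> M)"
    unfolding bij_betw_def
  proof
    show "inj_on straightening (I \<times> M)"
      by (rule inj_onI) (auto simp: straightening_def dest: flow_inj)
    show "straightening ` (I \<times> M) = I \<times> M"
    proof (intro equalityI subsetI)
      fix p assume "p \<in> I \<times> M"
      then obtain t y where p: "p = (t, y)" "t \<in> I" "y \<in> M" by blast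
      then obtain x where "x \<in> M" "flow (t, x) = y" using flow_onto by metis
      with p show "p \<in> straightening ` (I \<times> M)"
        by (intro image_eqI[of _ _ "(t, x)"]) (auto simp: straightening_def)
    qed (auto simp: straightening_def flow_in_M)
  qed
  have eq: "straightening p = (fst p, flow p)" if "p \<in> I \<times> M" for p
    using that by (simp add: straightening_def)
  have "C1_on (\<lambda>p. (fst p, flow p)) (I \<times> M)"
    by (intro C1_on_Pair C1_on_fst C1_flow)
  then show "C1_on straightening (I \<times> M)"
    using C1_on_cong[OF \<open>open (I \<times> M)\<close>, of straightening "\<lambda>p. (fst p, flow p)"] eq by simp
  fix p D h
  assume p: "p \<in> I \<times> M" and D: "(straightening has_derivative D) (at p)" and "D h = 0"
  obtain t x where tx: "p = (t, x)" "t \<in> I" "x \<in> M" using p by blast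
  obtain X where "(flow has_derivative (\<lambda>(u, h). u *\<^sub>R v (t, flow (t, x)) + X (t, x) h)) (at (t, x))"
    and X: "((\<lambda>y. flow (t, y)) has_derivative X (t, x)) (at x)"
    using flow_derivative tx(2,3) by metis
  then have "((\<lambda>p. (fst p, flow p)) has_derivative
      (\<lambda>h. (fst h, (\<lambda>(u, h). u *\<^sub>R v (t, flow (t, x)) + X (t, x) h) h))) (at p)"
    unfolding tx(1) by (intro has_derivative_Pair has_derivative_fst has_derivative_ident)
  then have "(straightening has_derivative
      (\<lambda>h. (fst h, (\<lambda>(u, h). u *\<^sub>R v (t, flow (t, x)) + X (t, x) h) h))) (at p)"
    by (rule has_derivative_transform_within_open[OF _ \<open>open (I \<times> M)\<close> p]) (simp add: eq)
  from has_derivative_unique[OF D this] \<open>D h = 0\<close>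
  have "fst h = 0" "X (t, x) (snd h) = 0"
    by (auto simp: case_prod_beta' zero_prod_def)
  then show "h = 0"
    using flow_derivative_injective[OF tx(2,3) X] by (simp add: prod_eq_iff)
qed

text \<open>By uniqueness each solution is a restriction of a global one, so the solution graphs are exactly
  the images of the horizontal segments under the straightening.\<close>
lemma (in complete_ode) solution_graphs:
  "(\<exists>J \<psi>. is_solution I M v J \<psi> \<and> graph_on J \<psi> = S) \<longleftrightarrow>
    (\<exists>J\<in>open_subintervals I. \<exists>x\<in>M. S = straightening ` (J \<times> {x}))"
proof -
  have graph: "graph_on J (\<lambda>t. flow (t, x)) = straightening ` (J \<times> {x})"
    if "J \<subseteq> I" "x \<in> M" for J x
  proof -
    have "straightening ` (J \<times> {x}) = (\<lambda>t. straightening (t, x)) ` J"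
      by (auto)
    also have "\<dots> = graph_on J (\<lambda>t. flow (t, x))"
      unfolding graph_on_def using that by (intro image_cong) (auto simp: straightening_def)
    finally show ?thesis by simp
  qed
  show ?thesis
  proof
    assume "\<exists>J \<psi>. is_solution I M v J \<psi> \<and> graph_on J \<psi> = S"
    then obtain J \<psi> where \<psi>: "is_solution I M v J \<psi>" "graph_on J \<psi> = S" by blast
    then have J: "J \<in> open_subintervals I" "J \<subseteq> I" "\<psi> ` J \<subseteq> M"
      by (auto simp: is_solution_def open_subintervals_def)
    then obtain s where s: "s \<in> J" by (auto simp: open_subintervals_def)
    then obtain x where x: "x \<in> M" "flow (s, x) = \<psi> s"
      using flow_onto[of s "\<psi> s"] J by blast
    have "\<psi> t = flow (t, x)" if "t \<in> J" for t
      using solution_unique[OF \<psi>(1) solution_subinterval[OF flow_solution[OF x(1)] J(1,2)] s that] x(2)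
      by simp
    then have "graph_on J \<psi> = graph_on J (\<lambda>t. flow (t, x))"
      by (auto simp: graph_on_def)
    then show "\<exists>J\<in>open_subintervals I. \<exists>x\<in>M. S = straightening ` (J \<times> {x})"
      using graph J x(1) \<psi>(2) by metis
  next
    assume "\<exists>J\<in>open_subintervals I. \<exists>x\<in>M. S = straightening ` (J \<times> {x})"
    then obtain J x where "J \<in> open_subintervals I" "x \<in> M" "S = straightening ` (J \<times> {x})" by blast
    then show "\<exists>J \<psi>. is_solution I M v J \<psi> \<and> graph_on J \<psi> = S"
      using graph[of J x] solution_subinterval[OF flow_solution, of x J]
      by (intro exI[of _ J] exI[of _ "\<lambda>t. flow (t, x)"]) (auto simp: open_subintervals_def)
  qed
qed

section \<open>Horizontal diffeomorphisms and the smooth wreath product\<close>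

text \<open>Elements of the wreath product as maps of \<open>I \<times> M\<close>: \<open>g\<close> permutes the horizontal lines, \<open>f x\<close>
  reparametrizes the line of height \<open>x\<close>. The restriction matches the representation of self-maps
  in \<^const>\<open>SYM\<close>.\<close>
definition wreath_action :: "real set \<Rightarrow> 'a set \<Rightarrow> ('a \<Rightarrow> real \<Rightarrow> real) \<times> ('a \<Rightarrow> 'a) \<Rightarrow> real \<times> 'a \<Rightarrow> real \<times> 'a" where
  "wreath_action I M w = (\<lambda>p\<in>I \<times> M. (fst w (snd p) (fst p), snd w (snd p)))"

text \<open>The global symmetries of \<open>x' = 0\<close>: horizontal segments are the graphs of its solutions.\<close>
definition horizontal_diffeos :: "real set \<Rightarrow> 'a::real_normed_vector set \<Rightarrow> (real \<times> 'a \<Rightarrow> real \<times> 'a) set" where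
  "horizontal_diffeos I M = {\<beta> \<in> carrier (SYM (I \<times> M)).
     \<forall>J\<in>open_subintervals I. \<forall>x\<in>M. \<exists>K\<in>open_subintervals I. \<exists>y\<in>M. \<beta> ` (J \<times> {x}) = K \<times> {y}}"

lemma wreath_carrier:
  "(f, g) \<in> carrier (smooth_wreath I M) \<longleftrightarrow>
    f \<in> extensional M \<and> (\<forall>x\<in>M. f x \<in> carrier (SYM I)) \<and> C1_on (\<lambda>(t, x). f x t) (I \<times> M) \<and>
    g \<in> carrier (SYM M)"
  by (auto simp: smooth_wreath_def smooth_fun_group_def PiE_iff)

lemma wreath_action_apply:
  "t \<in> I \<Longrightarrow> x \<in> M \<Longrightarrow> wreath_action I M (f, g) (t, x) = (f x t, g x)"
  by (simp add: wreath_action_def)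

text \<open>Stated for extensional pairs rather than elements of the wreath product, so that it can be used to
  show that products stay in the wreath product.\<close>
lemma wreath_action_inj:
  assumes "I \<noteq> {}" and eq: "wreath_action I M (f1, g1) = wreath_action I M (f2, g2)"
    and "f1 \<in> extensional M" "f2 \<in> extensional M" "g1 \<in> extensional M" "g2 \<in> extensional M"
    and "\<And>x. x \<in> M \<Longrightarrow> f1 x \<in> extensional I" "\<And>x. x \<in> M \<Longrightarrow> f2 x \<in> extensional I"
  shows "f1 = f2" "g1 = g2"
proof -
  have *: "f1 x t = f2 x t" "g1 x = g2 x" if "t \<in> I" "x \<in> M" for t x
    using fun_cong[OF eq, of "(t, x)"] that by (simp_all add: wreath_action_apply)
  show "g1 = g2"
    using assms(1) *(2) by (intro extensionalityI[OF assms(5,6)]) auto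
  show "f1 = f2"
    using * by (intro extensionalityI[OF assms(3,4)] extensionalityI[OF assms(7,8)])
qed

text \<open>The derivative of \<open>(t, x) \<mapsto> (f x t, g x)\<close> is block triangular with the derivatives of \<open>f x\<close> and
  \<open>g\<close> on the diagonal. Both are injective, since these maps have differentiable inverses, so the
  inverse function theorem yields joint smoothness of the inverse.\<close>
lemma wreath_action_in_SYM:
  fixes M :: "'a::euclidean_space set"
  assumes "open I" "open M" "(f, g) \<in> carrier (smooth_wreath I M)"
  shows "wreath_action I M (f, g) \<in> carrier (SYM (I \<times> M))"
proof (rule SYM_memI_derivative)
  let ?a = "wreath_action I M (f, g)"
  have f: "\<And>x. x \<in> M \<Longrightarrow> f x \<in> carrier (SYM I)" and C1_f: "C1_on (\<lambda>(t, x). f x t) (I \<times> M)"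
    and g: "g \<in> carrier (SYM M)"
    using assms(3) by (auto simp: wreath_carrier)
  show op: "open (I \<times> M)" using assms by (simp add: open_Times)
  show "?a \<in> extensional (I \<times> M)" by (simp add: wreath_action_def)
  show "bij_betw ?a (I \<times> M) (I \<times> M)"
  proof (rule bij_betwI[where g = "\<lambda>p. let x = inv_into M g (snd p) in (inv_into I (f x) (fst p), x)"])
    show "?a \<in> I \<times> M \<rightarrow> I \<times> M"
      using SYM_mem[OF f] SYM_mem[OF g] by (auto simp: wreath_action_apply)
    show "(\<lambda>p. let x = inv_into M g (snd p) in (inv_into I (f x) (fst p), x)) \<in> I \<times> M \<rightarrow> I \<times> M"
      using SYM_inv_into_mem[OF f] SYM_inv_into_mem[OF g] by (auto simp: Let_def)
  next
    fix p assume "p \<in> I \<times> M"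
    then show "(let x = inv_into M g (snd (?a p)) in (inv_into I (f x) (fst (?a p)), x)) = p"
      using SYM_inv_into(1)[OF f] SYM_inv_into(1)[OF g] by (auto simp: wreath_action_apply)
    from \<open>p \<in> I \<times> M\<close> show "?a (let x = inv_into M g (snd p) in (inv_into I (f x) (fst p), x)) = p"
      using SYM_inv_into_mem[OF g] SYM_inv_into_mem[OF f] SYM_inv_into(2)[OF f] SYM_inv_into(2)[OF g]
      by (auto simp: wreath_action_apply Let_def)
  qed
  have C1_g: "C1_on (\<lambda>p. g (snd p)) (I \<times> M)"
    by (rule C1_on_compose[OF SYM_C1(1)[OF g] C1_on_snd]) auto
  have C1: "C1_on (\<lambda>p. (f (snd p) (fst p), g (snd p))) (I \<times> M)"
    using C1_on_Pair[OF C1_f C1_g] by (simp add: case_prod_beta')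
  have eq: "?a p = (f (snd p) (fst p), g (snd p))" if "p \<in> I \<times> M" for p
    using that by (simp add: wreath_action_def)
  show "C1_on ?a (I \<times> M)"
    using C1_on_cong[OF op, of ?a "\<lambda>p. (f (snd p) (fst p), g (snd p))"] eq C1 by simp
  fix p D h
  assume p: "p \<in> I \<times> M" and D: "(?a has_derivative D) (at p)" and "D h = 0"
  obtain t x where tx: "p = (t, x)" "t \<in> I" "x \<in> M" using p by blast
  have D': "((\<lambda>p. (f (snd p) (fst p), g (snd p))) has_derivative D) (at p)"
    using has_derivative_transform_within_open[OF D op p eq] .
  obtain G where G: "(g has_derivative G) (at x)"
    using SYM_C1(1)[OF g] tx(3) unfolding C1_on_def by blast
  have "((\<lambda>p. g (snd p)) has_derivative (\<lambda>h. G (snd h))) (at p)"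
    using has_derivative_compose[OF bounded_linear_imp_has_derivative[OF bounded_linear_snd], of g G p UNIV] G tx(1)
    by simp
  moreover have "((\<lambda>p. g (snd p)) has_derivative (\<lambda>h. snd (D h))) (at p)"
    using has_derivative_snd[OF D'] by simp
  ultimately have "(\<lambda>h. snd (D h)) = (\<lambda>h. G (snd h))"
    by (rule has_derivative_unique[rotated])
  then have "snd (D h) = G (snd h)"
    by (rule fun_cong)
  then have "G (snd h) = 0" using \<open>D h = 0\<close> by simp
  then have "snd h = 0"
    using SYM_derivative_injective[OF assms(2) g tx(3) G] by blast
  have "((\<lambda>s. (s, x)) has_derivative (\<lambda>u. (u, 0))) (at t)"
    by (intro has_derivative_Pair has_derivative_ident has_derivative_const)
  from has_derivative_compose[OF this, of "\<lambda>p. (f (snd p) (fst p), g (snd p))" D] D' tx(1)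
  have "((\<lambda>s. (f x s, g x)) has_derivative (\<lambda>u. D (u, 0))) (at t)"
    by simp
  from has_derivative_fst[OF this]
  have "(f x has_derivative (\<lambda>u. fst (D (u, 0)))) (at t)"
    by simp
  from SYM_derivative_injective[OF assms(1) f[OF tx(3)] tx(2) this, of "fst h"]
  have "fst h = 0"
    using \<open>D h = 0\<close> \<open>snd h = 0\<close> by (metis fst_zero prod.collapse)
  with \<open>snd h = 0\<close> show "h = 0" by (simp add: prod_eq_iff)
qed

lemma wreath_action_image:
  assumes "J \<subseteq> I" "x \<in> M"
  shows "wreath_action I M (f, g) ` (J \<times> {x}) = f x ` J \<times> {g x}"
proof -
  have "wreath_action I M (f, g) ` (J \<times> {x}) = (\<lambda>t. (f x t, g x)) ` J"
    using assms by (force simp: wreath_action_apply subset_iff image_iff)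
  then show ?thesis by auto
qed

text \<open>The heart of the algebraic part: the images of the lines \<open>I \<times> {x}\<close> at a common height \<open>y\<close>
  partition \<open>I \<times> {y}\<close> into open segments, and \<open>I\<close> is connected. A symmetry is only assumed to map
  segments onto segments, so it is here that shrinking a whole line to a shorter segment, and sending two
  lines to the same height, are excluded.\<close>
lemma horizontal_diffeo_preserves_lines:
  fixes M :: "'a::euclidean_space set"
  assumes I: "I \<noteq> {}" "open I" "is_interval I" and \<beta>: "\<beta> \<in> horizontal_diffeos I M"
  obtains g where "\<And>x. x \<in> M \<Longrightarrow> g x \<in> M" "inj_on g M" "\<And>x. x \<in> M \<Longrightarrow> \<beta> ` (I \<times> {x}) = I \<times> {g x}"
proof -
  have \<beta>S: "\<beta> \<in> carrier (SYM (I \<times> M))"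
    and hor: "\<And>x. x \<in> M \<Longrightarrow> \<exists>K\<in>open_subintervals I. \<exists>y\<in>M. \<beta> ` (I \<times> {x}) = K \<times> {y}"
    using \<beta> I by (auto simp: horizontal_diffeos_def open_subintervals_def)
  then obtain K g where K: "\<And>x. x \<in> M \<Longrightarrow> K x \<in> open_subintervals I"
    and g: "\<And>x. x \<in> M \<Longrightarrow> g x \<in> M" and im: "\<And>x. x \<in> M \<Longrightarrow> \<beta> ` (I \<times> {x}) = K x \<times> {g x}"
    by metis
  have inj: "inj_on \<beta> (I \<times> M)" and surj: "\<beta> ` (I \<times> M) = I \<times> M"
    using \<beta>S by (auto simp: SYM_carrier Bij_def bij_betw_def)
  have disj: "K x \<inter> K z = {}" if "x \<in> M" "z \<in> M" "x \<noteq> z" "g x = g z" for x z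
  proof -
    have "(K x \<inter> K z) \<times> {g x} = \<beta> ` (I \<times> {x}) \<inter> \<beta> ` (I \<times> {z})"
      using im that by auto
    also have "\<dots> = \<beta> ` ((I \<times> {x}) \<inter> (I \<times> {z}))"
      using that by (intro inj_on_image_Int[OF inj, symmetric]) auto
    also have "\<dots> = {}" using that by auto
    finally show ?thesis by simp
  qed
  have full: "K x = I \<and> (\<forall>z\<in>M. g z = g x \<longrightarrow> z = x)" if x: "x \<in> M" for x
  proof -
    \<comment> \<open>The part of the line of height \<open>g x\<close> covered by the images of the other lines.\<close>
    define B where "B = \<Union>(K ` {z \<in> M. g z = g x \<and> z \<noteq> x})"
    have "I \<subseteq> K x \<union> B"
    proof
      fix s assume "s \<in> I"
      then have "(s, g x) \<in> \<beta> ` (I \<times> M)" using g[OF x] surj by simp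
      then obtain t z where z: "t \<in> I" "z \<in> M" "(s, g x) = \<beta> (t, z)" by auto
      then have "(s, g x) \<in> K z \<times> {g z}" using im by blast
      then show "s \<in> K x \<union> B" using z(2) by (auto simp: B_def)
    qed
    moreover have "K x \<inter> B = {}" using disj x by (auto simp: B_def)
    moreover have "open (K x)" "open B" "K x \<noteq> {}" "K x \<subseteq> I" "B \<subseteq> I"
      using K x by (auto simp: B_def open_subintervals_def)
    moreover have "connected I" using I(3) by (simp add: is_interval_connected_1)
    ultimately have "B = {}"
      using connectedD[of I "K x" B] by blast
    then have "K x = I" using \<open>I \<subseteq> K x \<union> B\<close> \<open>K x \<subseteq> I\<close> by auto
    moreover have "z = x" if "z \<in> M" "g z = g x" for z
    proof (rule ccontr)
      assume "z \<noteq> x"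
      then have "K z \<subseteq> B" using that by (auto simp: B_def)
      then show False using \<open>B = {}\<close> K[OF that(1)] by (simp add: open_subintervals_def)
    qed
    ultimately show ?thesis by blast
  qed
  show ?thesis
  proof (rule that[of g])
    show "inj_on g M" using full unfolding inj_on_def by metis
    show "\<beta> ` (I \<times> {x}) = I \<times> {g x}" if "x \<in> M" for x
      using im[OF that] full[OF that] by simp
  qed (rule g)
qed

text \<open>With whole lines preserved, \<open>f\<close> and \<open>g\<close> are read off as the components of \<open>\<beta>\<close>, and the inverses of
  \<open>f x\<close> and \<open>g\<close> as the components of the inverse of \<open>\<beta>\<close>, which makes all of them smooth.\<close>
lemma horizontal_diffeo_is_wreath_action:
  fixes M :: "'a::euclidean_space set"
  assumes I: "I \<noteq> {}" "open I" "is_interval I" and "open M" and \<beta>: "\<beta> \<in> horizontal_diffeos I M"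
  obtains f g where "(f, g) \<in> carrier (smooth_wreath I M)" "\<beta> = wreath_action I M (f, g)"
proof -
  have \<beta>S: "\<beta> \<in> carrier (SYM (I \<times> M))"
    using \<beta> by (simp add: horizontal_diffeos_def)
  let ?\<gamma> = "inv_into (I \<times> M) \<beta>"
  obtain g0 where g0: "\<And>x. x \<in> M \<Longrightarrow> g0 x \<in> M" and inj: "inj_on g0 M"
    and line: "\<And>x. x \<in> M \<Longrightarrow> \<beta> ` (I \<times> {x}) = I \<times> {g0 x}"
    using horizontal_diffeo_preserves_lines[OF I \<beta>] by metis
  obtain c where c: "c \<in> I" using I(1) by blast
  define f where "f = (\<lambda>x\<in>M. \<lambda>t\<in>I. fst (\<beta> (t, x)))"
  define g where "g = restrict g0 M"
  have form: "\<beta> (t, x) = (f x t, g x)" if "t \<in> I" "x \<in> M" for t x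
  proof -
    have "\<beta> (t, x) \<in> I \<times> {g0 x}" using line[OF that(2)] that(1) by blast
    then show ?thesis using that by (auto simp: f_def g_def prod_eq_iff)
  qed
  have f_mem: "f x t \<in> I" if "t \<in> I" "x \<in> M" for t x
    using SYM_mem[OF \<beta>S, of "(t, x)"] that form by simp
  have g_mem: "g x \<in> M" if "x \<in> M" for x
    using g0 that by (simp add: g_def)
  have g_surj: "\<exists>x\<in>M. g x = y" if "y \<in> M" for y
  proof -
    have p: "?\<gamma> (c, y) \<in> I \<times> M" using SYM_inv_into_mem[OF \<beta>S] c that by simp
    then have "\<beta> (?\<gamma> (c, y)) = (c, y)" using SYM_inv_into(2)[OF \<beta>S] c that by simp
    with p show ?thesis using form by (metis mem_Times_iff prod.collapse snd_conv)
  qed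
  have \<gamma>: "snd (?\<gamma> (s, g x)) = x \<and> fst (?\<gamma> (s, g x)) \<in> I \<and> f x (fst (?\<gamma> (s, g x))) = s"
    if s: "s \<in> I" and x: "x \<in> M" for s x
  proof -
    have "(s, g x) \<in> \<beta> ` (I \<times> {x})" using line[OF x] s x by (simp add: g_def)
    then obtain t where t: "t \<in> I" "\<beta> (t, x) = (s, g x)" by auto
    then have "?\<gamma> (s, g x) = (t, x)"
      using SYM_inv_into(1)[OF \<beta>S, of "(t, x)"] x by simp
    then show ?thesis using t form[OF t(1) x] by simp
  qed
  have \<gamma>_f: "?\<gamma> (f x t, g x) = (t, x)" if "t \<in> I" "x \<in> M" for t x
    using SYM_inv_into(1)[OF \<beta>S, of "(t, x)"] form that by simp
  have C1_pair: "C1_on (\<lambda>t. (t, x)) U" for x :: 'a and U :: "real set"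
    by (intro C1_on_Pair C1_on_id C1_on_const)
  have C1_pair': "C1_on (\<lambda>x. (t, x)) U" for t :: real and U :: "'a set"
    by (intro C1_on_Pair C1_on_id C1_on_const)
  have C1_fst: "C1_on (\<lambda>x. fst (h x)) U" if "C1_on h U" for h :: "'b::real_normed_vector \<Rightarrow> real \<times> 'a" and U
    using C1_on_compose[OF C1_on_fst that, of UNIV] by simp
  have C1_snd: "C1_on (\<lambda>x. snd (h x)) U" if "C1_on h U" for h :: "'b::real_normed_vector \<Rightarrow> real \<times> 'a" and U
    using C1_on_compose[OF C1_on_snd that, of UNIV] by simp
  have f_SYM: "f x \<in> carrier (SYM I)" if x: "x \<in> M" for x
  proof (rule SYM_memI[OF I(2), where k = "\<lambda>s. fst (?\<gamma> (s, g x))"])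
    show "f x \<in> extensional I" using x by (simp add: f_def)
    have "C1_on (\<lambda>t. fst (\<beta> (t, x))) I"
      by (intro C1_fst C1_on_compose[OF SYM_C1(1)[OF \<beta>S] C1_pair]) (use x in auto)
    then show "C1_on (f x) I"
      using C1_on_cong[OF I(2), of "f x" "\<lambda>t. fst (\<beta> (t, x))"] form x by simp
    show "C1_on (\<lambda>s. fst (?\<gamma> (s, g x))) I"
      by (intro C1_fst C1_on_compose[OF SYM_C1(2)[OF \<beta>S] C1_pair]) (use x g_mem in auto)
  qed (use x \<gamma> \<gamma>_f f_mem in auto)
  have \<gamma>_snd: "snd (?\<gamma> (c, y)) \<in> M \<and> g (snd (?\<gamma> (c, y))) = y" if "y \<in> M" for y
    using g_surj[OF that] \<gamma>[OF c] by auto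
  have "g \<in> carrier (SYM M)"
  proof (rule SYM_memI[OF assms(4), where k = "\<lambda>y. snd (?\<gamma> (c, y))"])
    show "g \<in> extensional M" by (simp add: g_def)
    have "C1_on (\<lambda>x. snd (\<beta> (c, x))) M"
      by (intro C1_snd C1_on_compose[OF SYM_C1(1)[OF \<beta>S] C1_pair']) (use c in auto)
    then show "C1_on g M"
      using C1_on_cong[OF assms(4), of g "\<lambda>x. snd (\<beta> (c, x))"] form c by simp
    show "C1_on (\<lambda>y. snd (?\<gamma> (c, y))) M"
      by (intro C1_snd C1_on_compose[OF SYM_C1(2)[OF \<beta>S] C1_pair']) (use c in auto)
  qed (use \<gamma>_snd \<gamma>[OF c] g_mem in auto)
  moreover have "C1_on (\<lambda>(t, x). f x t) (I \<times> M)"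
  proof -
    have "C1_on (\<lambda>p. fst (\<beta> p)) (I \<times> M)"
      by (rule C1_fst[OF SYM_C1(1)[OF \<beta>S]])
    then show ?thesis
      using C1_on_cong[OF open_Times[OF I(2) assms(4)], of "\<lambda>(t, x). f x t" "\<lambda>p. fst (\<beta> p)"] form
      by (auto simp: case_prod_beta')
  qed
  moreover have "f \<in> extensional M" by (simp add: f_def)
  ultimately have "(f, g) \<in> carrier (smooth_wreath I M)"
    using f_SYM by (simp add: wreath_carrier)
  moreover have "\<beta> = wreath_action I M (f, g)"
  proof (rule extensionalityI)
    show "\<beta> \<in> extensional (I \<times> M)" using \<beta>S by (simp add: SYM_carrier Bij_def)
    show "wreath_action I M (f, g) \<in> extensional (I \<times> M)" by (simp add: wreath_action_def)
    show "\<beta> p = wreath_action I M (f, g) p" if "p \<in> I \<times> M" for p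
      using that form by (auto simp: wreath_action_apply)
  qed
  ultimately show ?thesis by (rule that)
qed

lemma horizontal_diffeos_eq:
  fixes M :: "'a::euclidean_space set"
  assumes I: "I \<noteq> {}" "open I" "is_interval I" and "open M"
  shows "wreath_action I M ` carrier (smooth_wreath I M) = horizontal_diffeos I M"
proof (intro equalityI subsetI)
  fix \<beta> assume "\<beta> \<in> wreath_action I M ` carrier (smooth_wreath I M)"
  then obtain f g where fg: "(f, g) \<in> carrier (smooth_wreath I M)" and \<beta>: "\<beta> = wreath_action I M (f, g)"
    by auto
  have "\<exists>K\<in>open_subintervals I. \<exists>y\<in>M. \<beta> ` (J \<times> {x}) = K \<times> {y}"
    if J: "J \<in> open_subintervals I" and x: "x \<in> M" for J x
  proof -
    have fx: "f x \<in> carrier (SYM I)" and g: "g \<in> carrier (SYM M)"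
      using fg x by (simp_all add: wreath_carrier)
    have "\<beta> ` (J \<times> {x}) = f x ` J \<times> {g x}"
      unfolding \<beta> using J x by (intro wreath_action_image) (simp add: open_subintervals_def)
    then show ?thesis
      using SYM_image_open_subinterval[OF I(2) fx J] SYM_mem[OF g x] by blast
  qed
  then show "\<beta> \<in> horizontal_diffeos I M"
    using wreath_action_in_SYM[OF I(2) assms(4) fg] \<beta> by (simp add: horizontal_diffeos_def)
next
  fix \<beta> assume "\<beta> \<in> horizontal_diffeos I M"
  from horizontal_diffeo_is_wreath_action[OF I assms(4) this]
  show "\<beta> \<in> wreath_action I M ` carrier (smooth_wreath I M)" by blast
qed

text \<open>The definition asks only for segments to be moved forwards. Closure under inverses holds since in the
  form \<open>(t, x) \<mapsto> (f x t, g x)\<close> every segment \<open>K \<times> {g x}\<close> is the image of the segment over the preimage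
  of \<open>K\<close> under \<open>f x\<close>.\<close>
lemma horizontal_diffeos_subgroup:
  fixes M :: "'a::euclidean_space set"
  assumes I: "I \<noteq> {}" "open I" "is_interval I" and "open M"
  shows "subgroup (horizontal_diffeos I M) (SYM (I \<times> M))"
proof -
  let ?S = "SYM (I \<times> M)" and ?H = "horizontal_diffeos I M"
  have op: "open (I \<times> M)" using I(2) assms(4) by (rule open_Times)
  interpret group ?S by (rule group_SYM[OF op])
  have sub: "J \<times> {x} \<subseteq> I \<times> M" if "J \<in> open_subintervals I" "x \<in> M" for J x
    using that by (auto simp: open_subintervals_def)
  show ?thesis
  proof (rule subgroupI)
    show "?H \<subseteq> carrier ?S" by (auto simp: horizontal_diffeos_def)
    have "\<one>\<^bsub>?S\<^esub> ` (J \<times> {x}) = J \<times> {x}" if "J \<in> open_subintervals I" "x \<in> M" for J x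
      using sub[OF that] by (force simp: SYM_one)
    then have "\<one>\<^bsub>?S\<^esub> \<in> ?H"
      by (auto simp: horizontal_diffeos_def)
    then show "?H \<noteq> {}" by blast
  next
    fix \<beta> \<gamma> assume \<beta>: "\<beta> \<in> ?H" and \<gamma>: "\<gamma> \<in> ?H"
    have "\<exists>K\<in>open_subintervals I. \<exists>y\<in>M. (\<beta> \<otimes>\<^bsub>?S\<^esub> \<gamma>) ` (J \<times> {x}) = K \<times> {y}"
      if Jx: "J \<in> open_subintervals I" "x \<in> M" for J x
    proof -
      obtain K y where K: "K \<in> open_subintervals I" "y \<in> M" "\<gamma> ` (J \<times> {x}) = K \<times> {y}"
        using \<gamma> Jx unfolding horizontal_diffeos_def by blast
      have "(\<beta> \<otimes>\<^bsub>?S\<^esub> \<gamma>) ` (J \<times> {x}) = \<beta> ` (K \<times> {y})"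
        using \<beta> \<gamma> SYM_mult_image[OF _ _ sub[OF Jx], of \<beta> \<gamma>] K(3) by (simp add: horizontal_diffeos_def)
      then show ?thesis
        using \<beta> K(1,2) by (auto simp: horizontal_diffeos_def)
    qed
    then show "\<beta> \<otimes>\<^bsub>?S\<^esub> \<gamma> \<in> ?H"
      using \<beta> \<gamma> by (simp add: horizontal_diffeos_def)
  next
    fix \<beta> assume \<beta>: "\<beta> \<in> ?H"
    then have \<beta>S: "\<beta> \<in> carrier ?S" by (simp add: horizontal_diffeos_def)
    obtain f g where fg: "(f, g) \<in> carrier (smooth_wreath I M)" and eq: "\<beta> = wreath_action I M (f, g)"
      using horizontal_diffeo_is_wreath_action[OF I assms(4) \<beta>] .
    have "\<exists>J\<in>open_subintervals I. \<exists>x\<in>M. (inv\<^bsub>?S\<^esub> \<beta>) ` (K \<times> {y}) = J \<times> {x}"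
      if Ky: "K \<in> open_subintervals I" "y \<in> M" for K y
    proof -
      have g: "g \<in> carrier (SYM M)" using fg by (simp add: wreath_carrier)
      define x where "x = inv_into M g y"
      have x: "x \<in> M" "g x = y"
        using SYM_inv_into_mem[OF g Ky(2)] SYM_inv_into(2)[OF g Ky(2)] by (simp_all add: x_def)
      have fx: "f x \<in> carrier (SYM I)" using fg x by (simp add: wreath_carrier)
      define J where "J = (inv\<^bsub>SYM I\<^esub> f x) ` K"
      have J: "J \<in> open_subintervals I"
        unfolding J_def by (intro SYM_image_open_subinterval SYM_inv(1) I(2) fx Ky(1))
      have "f x ` J = K"
        unfolding J_def using SYM_inv_image(2)[OF I(2) fx] Ky(1) by (simp add: open_subintervals_def)
      then have "\<beta> ` (J \<times> {x}) = K \<times> {y}"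
        unfolding eq using wreath_action_image[of J I x M f g] J x by (simp add: open_subintervals_def)
      then have "(inv\<^bsub>?S\<^esub> \<beta>) ` (K \<times> {y}) = J \<times> {x}"
        using SYM_inv_image(1)[OF op \<beta>S sub[OF J x(1)]] by simp
      then show ?thesis using J x(1) by blast
    qed
    then show "inv\<^bsub>?S\<^esub> \<beta> \<in> ?H"
      using \<beta>S by (simp add: horizontal_diffeos_def)
  qed
qed

lemma wreath_action_mult:
  fixes M :: "'a::euclidean_space set"
  assumes "open I" "open M" "w1 \<in> carrier (smooth_wreath I M)" "w2 \<in> carrier (smooth_wreath I M)"
  shows "wreath_action I M (w1 \<otimes>\<^bsub>smooth_wreath I M\<^esub> w2)
    = wreath_action I M w1 \<otimes>\<^bsub>SYM (I \<times> M)\<^esub> wreath_action I M w2"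
proof -
  obtain f1 g1 f2 g2 where w: "w1 = (f1, g1)" "w2 = (f2, g2)"
    by (meson surj_pair)
  have S: "wreath_action I M w1 \<in> carrier (SYM (I \<times> M))" "wreath_action I M w2 \<in> carrier (SYM (I \<times> M))"
    using wreath_action_in_SYM[OF assms(1,2)] assms(3,4) w by blast+
  have mem: "f2 x t \<in> I" "g2 x \<in> M" if "t \<in> I" "x \<in> M" for t x
    using assms(4) that SYM_mem by (auto simp: w wreath_carrier)
  show ?thesis
    unfolding SYM_mult[OF S]
  proof (rule extensionalityI)
    fix p assume "p \<in> I \<times> M"
    then obtain t x where p: "p = (t, x)" "t \<in> I" "x \<in> M" by blast
    with mem[of t x] show "wreath_action I M (w1 \<otimes>\<^bsub>smooth_wreath I M\<^esub> w2) p
      = compose (I \<times> M) (wreath_action I M w1) (wreath_action I M w2) p"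
      using assms(3,4) by (simp add: w smooth_wreath_mult wreath_action_apply compose_eq)
  qed (auto simp: wreath_action_def)
qed

lemma wreath_action_inj_on:
  fixes M :: "'a::euclidean_space set"
  assumes "I \<noteq> {}"
  shows "inj_on (wreath_action I M) (carrier (smooth_wreath I M))"
proof (rule inj_onI)
  fix w1 w2
  assume w: "w1 \<in> carrier (smooth_wreath I M)" "w2 \<in> carrier (smooth_wreath I M)"
    and eq: "wreath_action I M w1 = wreath_action I M w2"
  obtain f1 g1 f2 g2 where fg: "w1 = (f1, g1)" "w2 = (f2, g2)"
    by (meson surj_pair)
  have "f1 = f2" "g1 = g2"
    using w wreath_action_inj[OF assms eq[unfolded fg]]
    by (auto simp: fg wreath_carrier SYM_carrier Bij_def)
  then show "w1 = w2" by (simp add: fg)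
qed

text \<open>The product acts as a composition of two horizontal diffeomorphisms, hence as some element of
  the wreath product, which it equals by injectivity. This replaces a direct proof that
  \<open>x \<mapsto> f1 (g2 x) \<circ> f2 x\<close> is smooth.\<close>
lemma wreath_mult_closed:
  fixes M :: "'a::euclidean_space set"
  assumes I: "I \<noteq> {}" "open I" "is_interval I" and "open M"
    and w: "w1 \<in> carrier (smooth_wreath I M)" "w2 \<in> carrier (smooth_wreath I M)"
  shows "w1 \<otimes>\<^bsub>smooth_wreath I M\<^esub> w2 \<in> carrier (smooth_wreath I M)"
proof -
  have "wreath_action I M w1 \<in> horizontal_diffeos I M" "wreath_action I M w2 \<in> horizontal_diffeos I M"
    using horizontal_diffeos_eq[OF assms(1-4)] w by blast+
  then have "wreath_action I M (w1 \<otimes>\<^bsub>smooth_wreath I M\<^esub> w2) \<in> horizontal_diffeos I M"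
    unfolding wreath_action_mult[OF I(2) assms(4) w]
    using horizontal_diffeos_subgroup[OF assms(1-4)] subgroup.m_closed by metis
  then obtain f g where fg: "(f, g) \<in> carrier (smooth_wreath I M)"
    and eq: "wreath_action I M (w1 \<otimes>\<^bsub>smooth_wreath I M\<^esub> w2) = wreath_action I M (f, g)"
    using horizontal_diffeo_is_wreath_action[OF assms(1-4)] by metis
  obtain f1 g1 f2 g2 where w12: "w1 = (f1, g1)" "w2 = (f2, g2)"
    by (meson surj_pair)
  have m: "w1 \<otimes>\<^bsub>smooth_wreath I M\<^esub> w2 = (\<lambda>x\<in>M. compose I (f1 (g2 x)) (f2 x), compose M g1 g2)"
    using smooth_wreath_mult w unfolding w12 by blast
  have "(\<lambda>x\<in>M. compose I (f1 (g2 x)) (f2 x)) = f" "compose M g1 g2 = g"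
    using wreath_action_inj[OF I(1) eq[unfolded m]] fg
    by (auto simp: wreath_carrier SYM_carrier Bij_def)
  then show ?thesis using m fg by simp
qed

lemma wreath_one:
  fixes M :: "'a::euclidean_space set"
  assumes I: "I \<noteq> {}" "open I" "is_interval I" and "open M"
  shows "\<one>\<^bsub>smooth_wreath I M\<^esub> \<in> carrier (smooth_wreath I M)"
    and "wreath_action I M \<one>\<^bsub>smooth_wreath I M\<^esub> = \<one>\<^bsub>SYM (I \<times> M)\<^esub>"
proof -
  have one: "\<one>\<^bsub>smooth_wreath I M\<^esub> = (\<lambda>x\<in>M. \<one>\<^bsub>SYM I\<^esub>, \<one>\<^bsub>SYM M\<^esub>)"
    by (simp add: smooth_wreath_def smooth_fun_group_def)
  have fst: "(\<lambda>(t, x). (\<lambda>x\<in>M. \<one>\<^bsub>SYM I\<^esub>) x t) p = fst p" if "p \<in> I \<times> M" for p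
    using that by (auto simp: SYM_one)
  have "C1_on (\<lambda>(t, x). (\<lambda>x\<in>M. \<one>\<^bsub>SYM I\<^esub>) x t) (I \<times> M)"
    by (rule iffD2[OF C1_on_cong[OF open_Times[OF I(2) assms(4)] fst] C1_on_fst])
  then show "\<one>\<^bsub>smooth_wreath I M\<^esub> \<in> carrier (smooth_wreath I M)"
    using group.subgroup_self[OF group_SYM[OF I(2)]] group.subgroup_self[OF group_SYM[OF assms(4)]]
    by (simp add: one wreath_carrier subgroup.one_closed)
  show "wreath_action I M \<one>\<^bsub>smooth_wreath I M\<^esub> = \<one>\<^bsub>SYM (I \<times> M)\<^esub>"
    by (auto simp: one wreath_action_def SYM_one fun_eq_iff)
qed

text \<open>The group laws of the wreath product are inherited from the horizontal diffeomorphisms along the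
  bijection.\<close>
lemma wreath_iso_horizontal_diffeos:
  fixes M :: "'a::euclidean_space set"
  assumes I: "I \<noteq> {}" "open I" "is_interval I" and "open M"
  defines "H \<equiv> (SYM (I \<times> M))\<lparr>carrier := horizontal_diffeos I M\<rparr>"
  shows "group (smooth_wreath I M)" and "H \<cong> smooth_wreath I M"
proof -
  let ?W = "smooth_wreath I M" and ?\<theta> = "wreath_action I M"
  interpret H: group H
    unfolding H_def
    using horizontal_diffeos_subgroup[OF assms(1-4)] group_SYM[OF open_Times[OF I(2) assms(4)]]
    by (rule subgroup.subgroup_is_group)
  have bij: "bij_betw ?\<theta> (carrier ?W) (carrier H)"
    unfolding bij_betw_def H_def using wreath_action_inj_on[OF I(1)] horizontal_diffeos_eq[OF assms(1-4)] by simp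
  let ?h = "inv_into (carrier ?W) ?\<theta>"
  have "?h \<in> iso H ?W"
  proof (rule isoI)
    show "bij_betw ?h (carrier H) (carrier ?W)"
      using bij by (rule bij_betw_inv_into)
    show "?h \<in> hom H ?W"
    proof (rule homI)
      show "?h \<beta> \<in> carrier ?W" if "\<beta> \<in> carrier H" for \<beta>
        using bij_betwE[OF bij_betw_inv_into[OF bij]] that by blast
      fix \<beta> \<gamma> assume "\<beta> \<in> carrier H" "\<gamma> \<in> carrier H"
      then obtain w1 w2 where w: "w1 \<in> carrier ?W" "w2 \<in> carrier ?W" "\<beta> = ?\<theta> w1" "\<gamma> = ?\<theta> w2"
        using bij_betw_imp_surj_on[OF bij] by blast
      then have "\<beta> \<otimes>\<^bsub>H\<^esub> \<gamma> = ?\<theta> (w1 \<otimes>\<^bsub>?W\<^esub> w2)"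
        using wreath_action_mult[OF I(2) assms(4) w(1,2)] by (simp add: H_def)
      then show "?h (\<beta> \<otimes>\<^bsub>H\<^esub> \<gamma>) = ?h \<beta> \<otimes>\<^bsub>?W\<^esub> ?h \<gamma>"
        using w wreath_mult_closed[OF assms(1-4) w(1,2)] bij_betw_inv_into_left[OF bij] by simp
    qed
  qed
  then show "H \<cong> ?W" by (rule is_isoI)
  have "?h \<one>\<^bsub>H\<^esub> = \<one>\<^bsub>?W\<^esub>"
    using bij_betw_inv_into_left[OF bij wreath_one(1)[OF assms(1-4)]] wreath_one(2)[OF assms(1-4)]
    by (simp add: H_def)
  then show "group ?W"
    using H.iso_imp_img_group[OF \<open>?h \<in> iso H ?W\<close>] by simp
qed

section \<open>The global symmetry group\<close>

text \<open>Moving solution graphs to solution graphs means, after conjugation with the straightening, moving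
  horizontal segments to horizontal segments.\<close>
lemma (in complete_ode) global_symmetry_iff:
  defines "S \<equiv> SYM (I \<times> M)"
  assumes \<alpha>: "\<alpha> \<in> carrier S"
  shows "global_symmetry I M v \<alpha> \<longleftrightarrow>
    inv\<^bsub>S\<^esub> straightening \<otimes>\<^bsub>S\<^esub> \<alpha> \<otimes>\<^bsub>S\<^esub> straightening \<in> horizontal_diffeos I M"
proof -
  have op: "open (I \<times> M)" using open_I open_M by (rule open_Times)
  interpret group S unfolding S_def by (rule group_SYM[OF op])
  have \<Phi>: "straightening \<in> carrier S" unfolding S_def by (rule straightening_in_SYM)
  let ?\<beta> = "inv\<^bsub>S\<^esub> straightening \<otimes>\<^bsub>S\<^esub> \<alpha> \<otimes>\<^bsub>S\<^esub> straightening"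
  have \<beta>: "?\<beta> \<in> carrier S" using \<alpha> \<Phi> by simp
  have conj: "?\<beta> ` A = B \<longleftrightarrow> \<alpha> ` (straightening ` A) = straightening ` B"
    if "A \<subseteq> I \<times> M" "B \<subseteq> I \<times> M" for A B
  proof -
    have sub: "straightening ` A \<subseteq> I \<times> M" "\<alpha> ` (straightening ` A) \<subseteq> I \<times> M"
      using that SYM_mem[OF \<Phi>[unfolded S_def]] SYM_mem[OF \<alpha>[unfolded S_def]] by blast+
    have "?\<beta> ` A = (inv\<^bsub>S\<^esub> straightening) ` (\<alpha> ` (straightening ` A))"
      using that sub \<Phi> \<alpha> unfolding S_def
      by (simp add: SYM_mult_image group.inv_closed[OF group_SYM[OF op]] monoid.m_closed[OF group.is_monoid[OF group_SYM[OF op]]])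
    then show ?thesis
      using SYM_inv_image(1)[OF op \<Phi>[unfolded S_def] that(2)]
        SYM_inv_image(2)[OF op \<Phi>[unfolded S_def] sub(2)]
      unfolding S_def by metis
  qed
  have line: "J \<times> {x} \<subseteq> I \<times> M" if "J \<in> open_subintervals I" "x \<in> M" for J x
    using that by (auto simp: open_subintervals_def)
  have "global_symmetry I M v \<alpha> \<longleftrightarrow>
      (\<forall>S. (\<exists>J \<phi>. is_solution I M v J \<phi> \<and> graph_on J \<phi> = S) \<longrightarrow>
        (\<exists>K \<psi>. is_solution I M v K \<psi> \<and> graph_on K \<psi> = \<alpha> ` S))"
    using \<alpha> unfolding S_def global_symmetry_def is_transform_def by metis
  also have "\<dots> \<longleftrightarrow> (\<forall>J\<in>open_subintervals I. \<forall>x\<in>M. \<exists>K\<in>open_subintervals I. \<exists>y\<in>M.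
      \<alpha> ` (straightening ` (J \<times> {x})) = straightening ` (K \<times> {y}))"
    unfolding solution_graphs by blast
  also have "\<dots> \<longleftrightarrow> (\<forall>J\<in>open_subintervals I. \<forall>x\<in>M. \<exists>K\<in>open_subintervals I. \<exists>y\<in>M.
      ?\<beta> ` (J \<times> {x}) = K \<times> {y})"
    using conj[OF line line] by simp
  also have "\<dots> \<longleftrightarrow> ?\<beta> \<in> horizontal_diffeos I M"
    using \<beta> by (simp add: horizontal_diffeos_def S_def)
  finally show ?thesis .
qed

lemma (in complete_ode) symmetry_group_iso_horizontal_diffeos:
  defines "H \<equiv> (SYM (I \<times> M))\<lparr>carrier := horizontal_diffeos I M\<rparr>"
  shows "group (global_symmetry_group I M v)" and "global_symmetry_group I M v \<cong> H"
proof -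
  define S where "S = SYM (I \<times> M)"
  let ?G = "global_symmetry_group I M v" and ?\<Phi> = straightening
  interpret S: group S unfolding S_def by (intro group_SYM open_Times open_I open_M)
  have sub: "subgroup (horizontal_diffeos I M) S"
    unfolding S_def by (rule horizontal_diffeos_subgroup[OF I_nonempty open_I interval_I open_M])
  interpret H: group H
    unfolding H_def S_def[symmetric] by (rule subgroup.subgroup_is_group[OF sub S.is_group])
  have \<Phi>: "?\<Phi> \<in> carrier S" unfolding S_def by (rule straightening_in_SYM)
  have HS: "carrier H \<subseteq> carrier S" using subgroup.subset[OF sub] by (simp add: H_def)
  let ?c = "\<lambda>\<beta>. ?\<Phi> \<otimes>\<^bsub>S\<^esub> \<beta> \<otimes>\<^bsub>S\<^esub> inv\<^bsub>S\<^esub> ?\<Phi>" and ?d = "\<lambda>\<alpha>. inv\<^bsub>S\<^esub> ?\<Phi> \<otimes>\<^bsub>S\<^esub> \<alpha> \<otimes>\<^bsub>S\<^esub> ?\<Phi>"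
  have cd: "?c (?d \<alpha>) = \<alpha>" "?d (?c \<alpha>) = \<alpha>" if "\<alpha> \<in> carrier S" for \<alpha>
    using \<Phi> that by (simp_all add: S.m_assoc S.inv_solve_left' S.inv_solve_right') (simp_all flip: S.m_assoc)
  have G: "\<alpha> \<in> carrier ?G \<longleftrightarrow> \<alpha> \<in> carrier S \<and> ?d \<alpha> \<in> carrier H" for \<alpha>
    using global_symmetry_iff[of \<alpha>] unfolding global_symmetry_group_def H_def S_def[symmetric]
    by (auto simp: global_symmetry_def S_def)
  have "?c \<in> iso H ?G"
  proof (rule isoI)
    show "bij_betw ?c (carrier H) (carrier ?G)"
      by (rule bij_betwI[of _ _ _ ?d]) (use cd G HS \<Phi> in auto)
    show "?c \<in> hom H ?G"
    proof (rule homI)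
      show "?c \<beta> \<in> carrier ?G" if "\<beta> \<in> carrier H" for \<beta>
        using that cd(2) G HS \<Phi> by auto
      fix \<beta> \<gamma> assume "\<beta> \<in> carrier H" "\<gamma> \<in> carrier H"
      then have "\<beta> \<in> carrier S" "\<gamma> \<in> carrier S" using HS by auto
      then have "?c (\<beta> \<otimes>\<^bsub>S\<^esub> \<gamma>) = ?c \<beta> \<otimes>\<^bsub>S\<^esub> ?c \<gamma>"
        using \<Phi> by (simp add: S.m_assoc) (simp flip: S.m_assoc)
      then show "?c (\<beta> \<otimes>\<^bsub>H\<^esub> \<gamma>) = ?c \<beta> \<otimes>\<^bsub>?G\<^esub> ?c \<gamma>"
        by (simp add: H_def global_symmetry_group_def S_def)
    qed
  qed
  then show "?G \<cong> H"
    using H.iso_sym is_isoI by blast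
  have "?c \<one>\<^bsub>H\<^esub> = \<one>\<^bsub>?G\<^esub>"
    using \<Phi> S.r_inv unfolding H_def global_symmetry_group_def S_def by (simp flip: S_def)
  then show "group ?G"
    using H.iso_imp_img_group[OF \<open>?c \<in> iso H ?G\<close>] by simp
qed

theorem corollary4p6:
  fixes I :: "real set" and M :: "(real ^ 'n) set"
    and v :: "real \<times> (real ^ 'n) \<Rightarrow> real ^ 'n" and L :: "real \<Rightarrow> real"
  assumes "I \<noteq> {}" and "open I" and "is_interval I"
    and "open M"
    and "C1_on v (I \<times> M)"
    and "continuous_on I L" and "\<And>t. t \<in> I \<Longrightarrow> 0 \<le> L t"
    and "\<And>t x1 x2. t \<in> I \<Longrightarrow> x1 \<in> M \<Longrightarrow> x2 \<in> M \<Longrightarrow>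
           norm (v (t, x1) - v (t, x2)) \<le> L t * norm (x1 - x2)"
    and "\<And>t0 x0. t0 \<in> I \<Longrightarrow> x0 \<in> M \<Longrightarrow>
           \<exists>\<phi>. maximal_cauchy_solution I M v t0 x0 I \<phi>"
  shows "group (global_symmetry_group I M v) \<and> group (smooth_wreath I M) \<and>
    global_symmetry_group I M v \<cong> smooth_wreath I M"
proof -
  interpret complete_ode I M v L
  proof
    show "\<exists>\<psi>. is_solution I M v I \<psi> \<and> \<psi> t = x" if "t \<in> I" "x \<in> M" for t x
      using assms(9)[OF that] unfolding maximal_cauchy_solution_def cauchy_solution_def by blast
  qed (use assms in auto)
  show ?thesis
    using symmetry_group_iso_horizontal_diffeos
      wreath_iso_horizontal_diffeos[OF assms(1-4)] iso_trans by blast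
qed

end
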